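(* Let $F:M_1\to M_2$ be a semi-invariant Riemannian submersion from a Kähler manifold $(M_1,g_1,J)$ onto a Riemannian manifold $(M_2,g_2)$. Then the distribution $(\ker F_* )^\perp$ defines a totally geodesic foliation if and only if $$\mathcal{A}_{Z_1}\mathcal{B}Z_2+\mathcal{H}\nabla^{1}_{Z_1}\mathcal{C}Z_2\in\Gamma(\mu)\quad\text{and}\quad \mathcal{A}_{Z_1}\mathcal{C}Z_2+\mathcal{V}\nabla^{1}_{Z_1}\mathcal{B}Z_2\in\Gamma(\mathcal{D}_2)$$ for all $Z_1,Z_2\in\Gamma((\ker F_* )^\perp)$.
   Context: A Riemannian submersion $F:(M_1,g_1)\to(M_2,g_2)$ (with $\dim M_1>\dim M_2$) is a smooth surjective map of maximal rank whose differential $F_*$ preserves the lengths of horizontal vectors, i.e. vectors orthogonal to $\ker F_*$. $\mathcal{V}$ and $\mathcal{H}$ denote the orthogonal projections of $TM_1$ onto $\ker F_*$ (vertical) and $(\ker F_* )^\perp$ (horizontal), and $\nabla^1$ is the Levi-Civita connection of $g_1$. $\Gamma(\cdot)$ denotes smooth sections. An almost Hermitian manifold $(M_1,g_1,J)$ satisfies $J^2=-I$ and $g_1(X,Y)=g_1(JX,JY)$; it is Kähler if $(\nabla^1_XJ)Y=0$ for all $X,Y$. A Riemannian submersion $F$ from an almost Hermitian manifold $(M_1,g_1,J)$ onto a Riemannian manifold $(M_2,g_2)$ is called semi-invariant if there is a distribution $\mathcal{D}_1\subseteq\ker F_*$ such that $\ker F_*=\mathcal{D}_1\oplus\mathcal{D}_2$,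 $J(\mathcal{D}_1)=\mathcal{D}_1$ and $J(\mathcal{D}_2)\subseteq(\ker F_* )^\perp$, where $\mathcal{D}_2$ is the orthogonal complement of $\mathcal{D}_1$ in $\ker F_*$. Let $\mu$ be the orthogonal complement of $J\mathcal{D}_2$ in $(\ker F_* )^\perp$. For $X\in\Gamma((\ker F_* )^\perp)$ write $JX=\mathcal{B}X+\mathcal{C}X$ with $\mathcal{B}X\in\Gamma(\mathcal{D}_2)$, $\mathcal{C}X\in\Gamma(\mu)$. O'Neill's tensor $\mathcal{A}$ is $\mathcal{A}_EG=\mathcal{H}\nabla^1_{\mathcal{H}E}\mathcal{V}G+\mathcal{V}\nabla^1_{\mathcal{H}E}\mathcal{H}G$ for vector fields $E,G$ on $M_1$. A distribution defines a totally geodesic foliation if $\nabla^1_{X}Y$ is a section of it for all sections $X,Y$ of it. *)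

theory Defs
  imports "HOL-Analysis.Analysis"
begin

section \<open>Smooth manifolds\<close>

text \<open>
  \<open>Ck_on k f S\<close> is meant for open \<open>S\<close>. In finite dimension, a map is \<open>C\<^sup>k\<^sup>+\<^sup>1\<close> iff it is
  differentiable and all its directional derivatives are \<open>C\<^sup>k\<close>.
\<close>

primrec Ck_on ::
  "nat \<Rightarrow> ('e::real_normed_vector \<Rightarrow> 'f::real_normed_vector) \<Rightarrow> 'e set \<Rightarrow> bool" where
  "Ck_on 0 f S \<longleftrightarrow> continuous_on S f"
| "Ck_on (Suc k) f S \<longleftrightarrow>
     (\<forall>x\<in>S. f differentiable (at x)) \<and>
     (\<forall>v. Ck_on k (\<lambda>x. frechet_derivative f (at x) v) S)"

definition smooth_on ::
  "('e::real_normed_vector \<Rightarrow> 'f::real_normed_vector) \<Rightarrow> 'e set \<Rightarrow> bool" where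
  "smooth_on f S \<longleftrightarrow> (\<forall>k. Ck_on k f S)"

type_synonym ('a, 'e) chart = "'a set \<times> ('a \<Rightarrow> 'e)"

abbreviation chart_dom :: "('a, 'e) chart \<Rightarrow> 'a set" where
  "chart_dom c \<equiv> fst c"

abbreviation chart_fun :: "('a, 'e) chart \<Rightarrow> 'a \<Rightarrow> 'e" where
  "chart_fun c \<equiv> snd c"

definition chart_inv :: "('a, 'e) chart \<Rightarrow> 'e \<Rightarrow> 'a" where
  "chart_inv c = inv_into (chart_dom c) (chart_fun c)"

definition is_chart :: "('a::topological_space, 'e::euclidean_space) chart \<Rightarrow> bool" where
  "is_chart c \<longleftrightarrow>
     open (chart_dom c) \<and> open (chart_fun c ` chart_dom c) \<and>
     homeomorphism (chart_dom c) (chart_fun c ` chart_dom c) (chart_fun c) (chart_inv c)"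

text \<open>
  The manifold is the whole (Hausdorff, second countable) type \<open>'a\<close>; its dimension is
  \<open>DIM('e)\<close>. The atlas need not be maximal.
\<close>

definition smooth_manifold ::
  "('a::{t2_space,second_countable_topology}, 'e::euclidean_space) chart set \<Rightarrow> bool" where
  "smooth_manifold A \<longleftrightarrow>
     (\<forall>c\<in>A. is_chart c) \<and> (\<Union>c\<in>A. chart_dom c) = UNIV \<and>
     (\<forall>c\<in>A. \<forall>d\<in>A. smooth_on (chart_fun d \<circ> chart_inv c)
                             (chart_fun c ` (chart_dom c \<inter> chart_dom d)))"

definition smooth_fun ::
  "('a::topological_space, 'e::euclidean_space) chart set \<Rightarrow> ('a \<Rightarrow> real) \<Rightarrow> bool" where
  "smooth_fun A f \<longleftrightarrow> (\<forall>c\<in>A. smooth_on (f \<circ> chart_inv c) (chart_fun c ` chart_dom c))"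

definition smooth_map ::
  "('a::topological_space, 'e::euclidean_space) chart set \<Rightarrow>
   ('b::topological_space, 'f::euclidean_space) chart set \<Rightarrow> ('a \<Rightarrow> 'b) \<Rightarrow> bool" where
  "smooth_map A B F \<longleftrightarrow> continuous_on UNIV F \<and>
     (\<forall>c\<in>A. \<forall>d\<in>B. smooth_on (chart_fun d \<circ> F \<circ> chart_inv c)
                             (chart_fun c ` (chart_dom c \<inter> F -` chart_dom d)))"

section \<open>Tangent vectors and vector fields\<close>

text \<open>
  Every point \<open>p\<close> gets a preferred chart \<open>chart_at A p\<close> around it. A tangent vector at \<open>p\<close> is
  represented by its coordinate vector in that chart, so \<open>T\<^sub>p M\<close> is the type \<open>'e\<close> and
  a vector field has type \<open>'a \<Rightarrow> 'e\<close>. As the preferred chart varies from point to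
  point without any continuity, smoothness must be tested after transforming to a fixed chart:
  \<open>to_chart A c p\<close> is the Jacobian sending a vector of \<open>T\<^sub>p M\<close> to its coordinates in \<open>c\<close>,
  and \<open>from_chart A c p\<close> is its inverse. In particular \<open>\<lambda>p. from_chart A c p v\<close> is the field
  with constant coordinates \<open>v\<close> in \<open>c\<close>.
\<close>

definition chart_at :: "('a, 'e) chart set \<Rightarrow> 'a \<Rightarrow> ('a, 'e) chart" where
  "chart_at A p = (SOME c. c \<in> A \<and> p \<in> chart_dom c)"

definition to_chart ::
  "('a, 'e::euclidean_space) chart set \<Rightarrow> ('a, 'e) chart \<Rightarrow> 'a \<Rightarrow> 'e \<Rightarrow> 'e" where
  "to_chart A c p =
     frechet_derivative (chart_fun c \<circ> chart_inv (chart_at A p)) (at (chart_fun (chart_at A p) p))"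

definition from_chart ::
  "('a, 'e::euclidean_space) chart set \<Rightarrow> ('a, 'e) chart \<Rightarrow> 'a \<Rightarrow> 'e \<Rightarrow> 'e" where
  "from_chart A c p =
     frechet_derivative (chart_fun (chart_at A p) \<circ> chart_inv c) (at (chart_fun c p))"

definition smooth_vfield_on ::
  "('a::topological_space, 'e::euclidean_space) chart set \<Rightarrow> 'a set \<Rightarrow> ('a \<Rightarrow> 'e) \<Rightarrow> bool" where
  "smooth_vfield_on A U X \<longleftrightarrow>
     (\<forall>c\<in>A. smooth_on (\<lambda>x. to_chart A c (chart_inv c x) (X (chart_inv c x)))
                      (chart_fun c ` (chart_dom c \<inter> U)))"

abbreviation smooth_vfield ::
  "('a::topological_space, 'e::euclidean_space) chart set \<Rightarrow> ('a \<Rightarrow> 'e) \<Rightarrow> bool" where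
  "smooth_vfield A X \<equiv> smooth_vfield_on A UNIV X"

definition deriv_along ::
  "('a, 'e::euclidean_space) chart set \<Rightarrow> ('a \<Rightarrow> 'e) \<Rightarrow> ('a \<Rightarrow> real) \<Rightarrow> 'a \<Rightarrow> real" where
  "deriv_along A X f p =
     frechet_derivative (f \<circ> chart_inv (chart_at A p)) (at (chart_fun (chart_at A p) p)) (X p)"

definition differential ::
  "('a, 'e::euclidean_space) chart set \<Rightarrow> ('b, 'f::euclidean_space) chart set \<Rightarrow>
   ('a \<Rightarrow> 'b) \<Rightarrow> 'a \<Rightarrow> 'e \<Rightarrow> 'f" where
  "differential A B F p =
     frechet_derivative (chart_fun (chart_at B (F p)) \<circ> F \<circ> chart_inv (chart_at A p))
                        (at (chart_fun (chart_at A p) p))"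

text \<open>
  A distribution is a smooth subbundle of the tangent bundle, given by smooth local frames. Its
  rank is locally constant, hence constant on connected manifolds.
\<close>

definition smooth_distribution ::
  "('a::topological_space, 'e::euclidean_space) chart set \<Rightarrow> ('a \<Rightarrow> 'e set) \<Rightarrow> bool" where
  "smooth_distribution A D \<longleftrightarrow>
     (\<forall>p. \<exists>U (k::nat) X. open U \<and> p \<in> U \<and> (\<forall>i<k. smooth_vfield_on A U (X i)) \<and>
        (\<forall>q\<in>U. inj_on (\<lambda>i. X i q) {..<k} \<and> independent ((\<lambda>i. X i q) ` {..<k}) \<and>
                span ((\<lambda>i. X i q) ` {..<k}) = D q))"

definition sections ::
  "('a::topological_space, 'e::euclidean_space) chart set \<Rightarrow> ('a \<Rightarrow> 'e set) \<Rightarrow> ('a \<Rightarrow> 'e) set" where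
  "sections A D = {X. smooth_vfield A X \<and> (\<forall>p. X p \<in> D p)}"

section \<open>Riemannian and Kaehler manifolds\<close>

definition riemannian_manifold ::
  "('a::{t2_space,second_countable_topology}, 'e::euclidean_space) chart set \<Rightarrow>
   ('a \<Rightarrow> 'e \<Rightarrow> 'e \<Rightarrow> real) \<Rightarrow> bool" where
  "riemannian_manifold A g \<longleftrightarrow> smooth_manifold A \<and>
     (\<forall>p. bilinear (g p) \<and> (\<forall>v w. g p v w = g p w v) \<and> (\<forall>v. v \<noteq> 0 \<longrightarrow> g p v v > 0)) \<and>
     (\<forall>c\<in>A. \<forall>v w.
        smooth_on (\<lambda>x. let p = chart_inv c x in g p (from_chart A c p v) (from_chart A c p w))
                  (chart_fun c ` chart_dom c))"

text \<open>
  A connection acts on global smooth vector fields; its values on other arguments are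
  irrelevant.
\<close>

definition affine_connection ::
  "('a::topological_space, 'e::euclidean_space) chart set \<Rightarrow>
   (('a \<Rightarrow> 'e) \<Rightarrow> ('a \<Rightarrow> 'e) \<Rightarrow> 'a \<Rightarrow> 'e) \<Rightarrow> bool" where
  "affine_connection A nabla \<longleftrightarrow>
     (\<forall>X Y. smooth_vfield A X \<longrightarrow> smooth_vfield A Y \<longrightarrow> smooth_vfield A (nabla X Y)) \<and>
     (\<forall>X X' Y. smooth_vfield A X \<longrightarrow> smooth_vfield A X' \<longrightarrow> smooth_vfield A Y \<longrightarrow>
        nabla (\<lambda>p. X p + X' p) Y = (\<lambda>p. nabla X Y p + nabla X' Y p)) \<and>
     (\<forall>f X Y. smooth_fun A f \<longrightarrow> smooth_vfield A X \<longrightarrow> smooth_vfield A Y \<longrightarrow>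
        nabla (\<lambda>p. f p *\<^sub>R X p) Y = (\<lambda>p. f p *\<^sub>R nabla X Y p)) \<and>
     (\<forall>X Y Y'. smooth_vfield A X \<longrightarrow> smooth_vfield A Y \<longrightarrow> smooth_vfield A Y' \<longrightarrow>
        nabla X (\<lambda>p. Y p + Y' p) = (\<lambda>p. nabla X Y p + nabla X Y' p)) \<and>
     (\<forall>f X Y. smooth_fun A f \<longrightarrow> smooth_vfield A X \<longrightarrow> smooth_vfield A Y \<longrightarrow>
        nabla X (\<lambda>p. f p *\<^sub>R Y p) = (\<lambda>p. deriv_along A X f p *\<^sub>R Y p + f p *\<^sub>R nabla X Y p))"

text \<open>The Lie bracket is the field acting on functions as the commutator.\<close>

definition is_lie_bracket ::
  "('a::topological_space, 'e::euclidean_space) chart set \<Rightarrow>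
   ('a \<Rightarrow> 'e) \<Rightarrow> ('a \<Rightarrow> 'e) \<Rightarrow> ('a \<Rightarrow> 'e) \<Rightarrow> bool" where
  "is_lie_bracket A X Y W \<longleftrightarrow>
     (\<forall>f. smooth_fun A f \<longrightarrow>
        deriv_along A W f =
          (\<lambda>p. deriv_along A X (deriv_along A Y f) p - deriv_along A Y (deriv_along A X f) p))"

definition levi_civita ::
  "('a::topological_space, 'e::euclidean_space) chart set \<Rightarrow> ('a \<Rightarrow> 'e \<Rightarrow> 'e \<Rightarrow> real) \<Rightarrow>
   (('a \<Rightarrow> 'e) \<Rightarrow> ('a \<Rightarrow> 'e) \<Rightarrow> 'a \<Rightarrow> 'e) \<Rightarrow> bool" where
  "levi_civita A g nabla \<longleftrightarrow> affine_connection A nabla \<and>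
     (\<forall>X Y. smooth_vfield A X \<longrightarrow> smooth_vfield A Y \<longrightarrow>
        is_lie_bracket A X Y (\<lambda>p. nabla X Y p - nabla Y X p)) \<and>
     (\<forall>X Y Z. smooth_vfield A X \<longrightarrow> smooth_vfield A Y \<longrightarrow> smooth_vfield A Z \<longrightarrow>
        deriv_along A X (\<lambda>p. g p (Y p) (Z p)) =
          (\<lambda>p. g p (nabla X Y p) (Z p) + g p (Y p) (nabla X Z p)))"

definition almost_hermitian ::
  "('a::{t2_space,second_countable_topology}, 'e::euclidean_space) chart set \<Rightarrow>
   ('a \<Rightarrow> 'e \<Rightarrow> 'e \<Rightarrow> real) \<Rightarrow> ('a \<Rightarrow> 'e \<Rightarrow> 'e) \<Rightarrow> bool" where
  "almost_hermitian A g J \<longleftrightarrow> riemannian_manifold A g \<and>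
     (\<forall>p. linear (J p)) \<and>
     (\<forall>c\<in>A. \<forall>v. smooth_vfield_on A (chart_dom c) (\<lambda>p. J p (from_chart A c p v))) \<and>
     (\<forall>p v. J p (J p v) = - v) \<and>
     (\<forall>p v w. g p v w = g p (J p v) (J p w))"

definition kaehler ::
  "('a::{t2_space,second_countable_topology}, 'e::euclidean_space) chart set \<Rightarrow>
   ('a \<Rightarrow> 'e \<Rightarrow> 'e \<Rightarrow> real) \<Rightarrow> ('a \<Rightarrow> 'e \<Rightarrow> 'e) \<Rightarrow>
   (('a \<Rightarrow> 'e) \<Rightarrow> ('a \<Rightarrow> 'e) \<Rightarrow> 'a \<Rightarrow> 'e) \<Rightarrow> bool" where
  "kaehler A g J nabla \<longleftrightarrow> almost_hermitian A g J \<and> levi_civita A g nabla \<and>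
     (\<forall>X Y. smooth_vfield A X \<longrightarrow> smooth_vfield A Y \<longrightarrow>
        (\<forall>p. nabla X (\<lambda>q. J q (Y q)) p - J p (nabla X Y p) = 0))"

section \<open>Semi-invariant Riemannian submersions\<close>

definition orth_in ::
  "('a \<Rightarrow> 'e \<Rightarrow> 'e \<Rightarrow> real) \<Rightarrow> ('a \<Rightarrow> 'e set) \<Rightarrow> ('a \<Rightarrow> 'e set) \<Rightarrow> 'a \<Rightarrow> 'e set" where
  "orth_in g E D p = {v \<in> E p. \<forall>w \<in> D p. g p v w = 0}"

definition orth_proj ::
  "('a \<Rightarrow> 'e \<Rightarrow> 'e \<Rightarrow> real) \<Rightarrow> ('a \<Rightarrow> 'e::euclidean_space set) \<Rightarrow> ('a \<Rightarrow> 'e) \<Rightarrow> 'a \<Rightarrow> 'e" where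
  "orth_proj g D X p = (THE w. w \<in> D p \<and> (\<forall>u \<in> D p. g p (X p - w) u = 0))"

definition vert ::
  "('a, 'e::euclidean_space) chart set \<Rightarrow> ('b, 'f::euclidean_space) chart set \<Rightarrow>
   ('a \<Rightarrow> 'b) \<Rightarrow> 'a \<Rightarrow> 'e set" where
  "vert A B F p = {v. differential A B F p v = 0}"

definition hor ::
  "('a, 'e::euclidean_space) chart set \<Rightarrow> ('a \<Rightarrow> 'e \<Rightarrow> 'e \<Rightarrow> real) \<Rightarrow>
   ('b, 'f::euclidean_space) chart set \<Rightarrow> ('a \<Rightarrow> 'b) \<Rightarrow> 'a \<Rightarrow> 'e set" where
  "hor A g B F = orth_in g (\<lambda>p. UNIV) (vert A B F)"

definition riemannian_submersion ::
  "('a::{t2_space,second_countable_topology}, 'e::euclidean_space) chart set \<Rightarrow>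
   ('a \<Rightarrow> 'e \<Rightarrow> 'e \<Rightarrow> real) \<Rightarrow>
   ('b::{t2_space,second_countable_topology}, 'f::euclidean_space) chart set \<Rightarrow>
   ('b \<Rightarrow> 'f \<Rightarrow> 'f \<Rightarrow> real) \<Rightarrow> ('a \<Rightarrow> 'b) \<Rightarrow> bool" where
  "riemannian_submersion A1 g1 A2 g2 F \<longleftrightarrow>
     riemannian_manifold A1 g1 \<and> riemannian_manifold A2 g2 \<and> DIM('e) > DIM('f) \<and>
     smooth_map A1 A2 F \<and> surj F \<and>
     (\<forall>p. dim (range (differential A1 A2 F p)) = DIM('f)) \<and>
     (\<forall>p. \<forall>v \<in> hor A1 g1 A2 F p.
        sqrt (g2 (F p) (differential A1 A2 F p v) (differential A1 A2 F p v)) = sqrt (g1 p v v))"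

definition D2 ::
  "('a, 'e::euclidean_space) chart set \<Rightarrow> ('a \<Rightarrow> 'e \<Rightarrow> 'e \<Rightarrow> real) \<Rightarrow>
   ('b, 'f::euclidean_space) chart set \<Rightarrow> ('a \<Rightarrow> 'b) \<Rightarrow> ('a \<Rightarrow> 'e set) \<Rightarrow> 'a \<Rightarrow> 'e set" where
  "D2 A g B F D1 = orth_in g (vert A B F) D1"

definition mu ::
  "('a, 'e::euclidean_space) chart set \<Rightarrow> ('a \<Rightarrow> 'e \<Rightarrow> 'e \<Rightarrow> real) \<Rightarrow> ('a \<Rightarrow> 'e \<Rightarrow> 'e) \<Rightarrow>
   ('b, 'f::euclidean_space) chart set \<Rightarrow> ('a \<Rightarrow> 'b) \<Rightarrow> ('a \<Rightarrow> 'e set) \<Rightarrow> 'a \<Rightarrow> 'e set" where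
  "mu A g J B F D1 = orth_in g (hor A g B F) (\<lambda>p. J p ` D2 A g B F D1 p)"

text \<open>
  The distribution \<open>D1\<close> witnessing semi-invariance is a parameter, since \<open>D2\<close>, \<open>mu\<close>,
  \<open>B_op\<close> and \<open>C_op\<close> refer to it.
\<close>

definition semi_invariant_submersion ::
  "('a::{t2_space,second_countable_topology}, 'e::euclidean_space) chart set \<Rightarrow>
   ('a \<Rightarrow> 'e \<Rightarrow> 'e \<Rightarrow> real) \<Rightarrow> ('a \<Rightarrow> 'e \<Rightarrow> 'e) \<Rightarrow>
   ('b::{t2_space,second_countable_topology}, 'f::euclidean_space) chart set \<Rightarrow>
   ('b \<Rightarrow> 'f \<Rightarrow> 'f \<Rightarrow> real) \<Rightarrow> ('a \<Rightarrow> 'b) \<Rightarrow> ('a \<Rightarrow> 'e set) \<Rightarrow> bool" where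
  "semi_invariant_submersion A1 g1 J A2 g2 F D1 \<longleftrightarrow>
     almost_hermitian A1 g1 J \<and> riemannian_submersion A1 g1 A2 g2 F \<and>
     smooth_distribution A1 D1 \<and>
     (\<forall>p. D1 p \<subseteq> vert A1 A2 F p \<and>
          vert A1 A2 F p = {a + b | a b. a \<in> D1 p \<and> b \<in> D2 A1 g1 A2 F D1 p} \<and>
          D1 p \<inter> D2 A1 g1 A2 F D1 p = {0} \<and>
          J p ` D1 p = D1 p \<and>
          J p ` D2 A1 g1 A2 F D1 p \<subseteq> hor A1 g1 A2 F p)"

text \<open>
  \<open>B_op\<close> and \<open>C_op\<close> are the components of \<open>JX = BX + CX\<close>; they are only meaningful for
  horizontal \<open>X\<close>, for which \<open>JX\<close> lies in the direct sum of \<open>D2\<close> and \<open>mu\<close>.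
\<close>

definition B_op ::
  "('a, 'e::euclidean_space) chart set \<Rightarrow> ('a \<Rightarrow> 'e \<Rightarrow> 'e \<Rightarrow> real) \<Rightarrow> ('a \<Rightarrow> 'e \<Rightarrow> 'e) \<Rightarrow>
   ('b, 'f::euclidean_space) chart set \<Rightarrow> ('a \<Rightarrow> 'b) \<Rightarrow> ('a \<Rightarrow> 'e set) \<Rightarrow>
   ('a \<Rightarrow> 'e) \<Rightarrow> 'a \<Rightarrow> 'e" where
  "B_op A g J B F D1 X p =
     (THE b. b \<in> D2 A g B F D1 p \<and> (\<exists>c \<in> mu A g J B F D1 p. J p (X p) = b + c))"

definition C_op ::
  "('a, 'e::euclidean_space) chart set \<Rightarrow> ('a \<Rightarrow> 'e \<Rightarrow> 'e \<Rightarrow> real) \<Rightarrow> ('a \<Rightarrow> 'e \<Rightarrow> 'e) \<Rightarrow>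
   ('b, 'f::euclidean_space) chart set \<Rightarrow> ('a \<Rightarrow> 'b) \<Rightarrow> ('a \<Rightarrow> 'e set) \<Rightarrow>
   ('a \<Rightarrow> 'e) \<Rightarrow> 'a \<Rightarrow> 'e" where
  "C_op A g J B F D1 X p =
     (THE c. c \<in> mu A g J B F D1 p \<and> (\<exists>b \<in> D2 A g B F D1 p. J p (X p) = b + c))"

definition V_proj ::
  "('a, 'e::euclidean_space) chart set \<Rightarrow> ('a \<Rightarrow> 'e \<Rightarrow> 'e \<Rightarrow> real) \<Rightarrow>
   ('b, 'f::euclidean_space) chart set \<Rightarrow> ('a \<Rightarrow> 'b) \<Rightarrow> ('a \<Rightarrow> 'e) \<Rightarrow> 'a \<Rightarrow> 'e" where
  "V_proj A g B F = orth_proj g (vert A B F)"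

definition H_proj ::
  "('a, 'e::euclidean_space) chart set \<Rightarrow> ('a \<Rightarrow> 'e \<Rightarrow> 'e \<Rightarrow> real) \<Rightarrow>
   ('b, 'f::euclidean_space) chart set \<Rightarrow> ('a \<Rightarrow> 'b) \<Rightarrow> ('a \<Rightarrow> 'e) \<Rightarrow> 'a \<Rightarrow> 'e" where
  "H_proj A g B F = orth_proj g (hor A g B F)"

definition oneill_A ::
  "('a, 'e::euclidean_space) chart set \<Rightarrow> ('a \<Rightarrow> 'e \<Rightarrow> 'e \<Rightarrow> real) \<Rightarrow>
   (('a \<Rightarrow> 'e) \<Rightarrow> ('a \<Rightarrow> 'e) \<Rightarrow> 'a \<Rightarrow> 'e) \<Rightarrow>
   ('b, 'f::euclidean_space) chart set \<Rightarrow> ('a \<Rightarrow> 'b) \<Rightarrow>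
   ('a \<Rightarrow> 'e) \<Rightarrow> ('a \<Rightarrow> 'e) \<Rightarrow> 'a \<Rightarrow> 'e" where
  "oneill_A A g nabla B F E G p =
     H_proj A g B F (nabla (H_proj A g B F E) (V_proj A g B F G)) p +
     V_proj A g B F (nabla (H_proj A g B F E) (H_proj A g B F G)) p"

definition totally_geodesic_foliation ::
  "('a::topological_space, 'e::euclidean_space) chart set \<Rightarrow>
   (('a \<Rightarrow> 'e) \<Rightarrow> ('a \<Rightarrow> 'e) \<Rightarrow> 'a \<Rightarrow> 'e) \<Rightarrow> ('a \<Rightarrow> 'e set) \<Rightarrow> bool" where
  "totally_geodesic_foliation A nabla D \<longleftrightarrow>
     (\<forall>X \<in> sections A D. \<forall>Y \<in> sections A D. nabla X Y \<in> sections A D)"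

end

theory Submission
  imports Defs
begin

text \<open>
  Let \<open>Z1\<close>, \<open>Z2\<close> be horizontal and \<open>W = nabla Z1 Z2\<close>. Since \<open>J\<close> is parallel,
  \<open>J W = nabla Z1 (J Z2) = nabla Z1 (\<B> Z2) + nabla Z1 (\<C> Z2)\<close>. As \<open>\<B> Z2\<close> is vertical and
  \<open>\<C> Z2\<close> is horizontal, the two expressions in the theorem are exactly the horizontal and the
  vertical part of \<open>J W\<close> (\<open>parts_of_J_nabla\<close>). On the other hand, pointwise linear algebra
  shows that \<open>J\<close> maps the horizontal space onto the orthogonal sum of \<open>\<D>\<^sub>2\<close> and \<open>\<mu>\<close>;
  so \<open>W\<close> is horizontal iff the horizontal part of \<open>J W\<close> lies in \<open>\<mu>\<close> and its vertical
  part in \<open>\<D>\<^sub>2\<close> (\<open>horizontal_iff_J_parts\<close>). The equivalence thus holds for every single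
  pair \<open>Z1\<close>, \<open>Z2\<close>.

  The analytic content is smoothness. Sections are smooth by definition and the connection obeys
  its rules only on smooth fields, so the argument needs that \<open>J\<close> and the horizontal and
  vertical projections preserve smoothness. For the projections this rests on
  \<open>smooth_Riesz_representation\<close>, a Gram--Schmidt process for inner products depending smoothly
  on a parameter: it provides the gradients of the components of the submersion in charts, which
  span the horizontal spaces, and then the projection to their span
  (\<open>smooth_horizontal_part_in_chart\<close>).
\<close>

section \<open>Calculus of smooth maps\<close>

text \<open>
  As \<open>Ck_on\<close> iterates directional derivatives, its closure properties are inductions on the
  order: the derivative of a sum, product or inverse is again built from maps that the induction
  hypothesis covers.
\<close>

lemma Ck_on_Suc_imp: "Ck_on (Suc k) f S \<Longrightarrow> Ck_on k f S"
proof (induction k arbitrary: f)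
  case 0
  then show ?case
    by (auto intro!: continuous_at_imp_continuous_on differentiable_imp_continuous_within)
next
  case (Suc k)
  then show ?case by (metis Ck_on.simps(2))
qed

lemma Ck_on_subset: "Ck_on k f S \<Longrightarrow> T \<subseteq> S \<Longrightarrow> Ck_on k f T"
  by (induction k arbitrary: f) (auto intro: continuous_on_subset)

lemma Ck_on_cong:
  assumes "open S" "\<And>x. x \<in> S \<Longrightarrow> f x = g x" "Ck_on k f S"
  shows "Ck_on k g S"
  using assms
proof (induction k arbitrary: f g)
  case 0
  then show ?case using continuous_on_cong[of S S f g] by auto
next
  case (Suc k)
  have der: "(g has_derivative frechet_derivative f (at x)) (at x)" if "x \<in> S" for x
  proof -
    have "(f has_derivative frechet_derivative f (at x)) (at x)"
      using Suc.prems(3) that by (simp add: frechet_derivative_works[symmetric])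
    then show ?thesis
      using Suc.prems(2) by (rule has_derivative_transform_within_open[OF _ \<open>open S\<close> that])
  qed
  have fr: "frechet_derivative g (at x) = frechet_derivative f (at x)" if "x \<in> S" for x
    using frechet_derivative_at[OF der[OF that]] by simp
  have "Ck_on k (\<lambda>x. frechet_derivative g (at x) v) S" for v
  proof (rule Suc.IH[OF \<open>open S\<close>])
    show "Ck_on k (\<lambda>x. frechet_derivative f (at x) v) S"
      using Suc.prems(3) by simp
  qed (simp only: fr)
  moreover have "g differentiable at x" if "x \<in> S" for x
    using der[OF that] by (rule differentiableI)
  ultimately show ?case by simp
qed

lemma Ck_on_local:
  assumes "\<And>x. x \<in> S \<Longrightarrow> \<exists>U. open U \<and> x \<in> U \<and> Ck_on k f U"
  shows "Ck_on k f S"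
  using assms
proof (induction k arbitrary: f)
  case 0
  show ?case unfolding Ck_on.simps
  proof (rule continuous_at_imp_continuous_on, rule ballI)
    fix x assume "x \<in> S"
    then obtain U where "open U" "x \<in> U" "continuous_on U f" using 0 by auto
    then show "isCont f x" by (simp add: continuous_on_eq_continuous_at)
  qed
next
  case (Suc k)
  have "Ck_on k (\<lambda>x. frechet_derivative f (at x) v) S" for v
  proof (rule Suc.IH)
    fix x assume "x \<in> S"
    then obtain U where "open U" "x \<in> U" "Ck_on (Suc k) f U" using Suc.prems by blast
    then show "\<exists>U. open U \<and> x \<in> U \<and> Ck_on k (\<lambda>x. frechet_derivative f (at x) v) U"
      by (intro exI[of _ U]) simp
  qed
  moreover have "f differentiable at x" if "x \<in> S" for x
    using Suc.prems[OF that] by auto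
  ultimately show ?case by simp
qed

lemma Ck_on_const: "Ck_on k (\<lambda>x. c) S"
  by (induction k arbitrary: c) (auto simp: frechet_derivative_const)

lemma Ck_on_SucI:
  assumes "open S" "\<And>x. x \<in> S \<Longrightarrow> (f has_derivative f' x) (at x)"
    and "\<And>v. Ck_on k (\<lambda>x. f' x v) S"
  shows "Ck_on (Suc k) f S"
proof -
  have "Ck_on k (\<lambda>x. frechet_derivative f (at x) v) S" for v
    by (rule Ck_on_cong[OF assms(1) _ assms(3)[of v]])
      (simp add: frechet_derivative_at[OF assms(2)])
  then show ?thesis using assms(2) by (auto simp: differentiable_def)
qed

lemma Ck_on_SucD:
  assumes "Ck_on (Suc k) f S" "x \<in> S"
  shows "(f has_derivative frechet_derivative f (at x)) (at x)"
  using assms by (simp add: frechet_derivative_works)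

lemma Ck_on_add:
  assumes "open S" "Ck_on k f S" "Ck_on k g S"
  shows "Ck_on k (\<lambda>x. f x + g x) S"
  using assms
proof (induction k arbitrary: f g)
  case 0
  then show ?case by (auto intro: continuous_on_add)
next
  case (Suc k)
  show ?case
    by (rule Ck_on_SucI[OF \<open>open S\<close> has_derivative_add[OF Ck_on_SucD Ck_on_SucD]])
      (use Suc in auto)
qed

lemma Ck_on_bilinear:
  assumes b: "bounded_bilinear b" and "open S" "Ck_on k f S" "Ck_on k g S"
  shows "Ck_on k (\<lambda>x. b (f x) (g x)) S"
  using assms(2-)
proof (induction k arbitrary: f g)
  case 0
  then show ?case using bounded_bilinear.continuous_on[OF b] by auto
next
  case (Suc k)
  note low = Ck_on_Suc_imp[OF Suc.prems(2)] Ck_on_Suc_imp[OF Suc.prems(3)]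
  show ?case
    by (rule Ck_on_SucI[OF \<open>open S\<close> bounded_bilinear.FDERIV[OF b Ck_on_SucD Ck_on_SucD]])
      (use Suc low in \<open>auto intro!: Ck_on_add\<close>)
qed

lemma Ck_on_inverse:
  fixes f :: "'e::real_normed_vector \<Rightarrow> real"
  assumes "open S" "Ck_on k f S" "\<And>x. x \<in> S \<Longrightarrow> f x \<noteq> 0"
  shows "Ck_on k (\<lambda>x. inverse (f x)) S"
  using assms
proof (induction k)
  case 0
  then show ?case by (auto intro: continuous_on_inverse)
next
  case (Suc k)
  \<comment> \<open>The derivative of \<open>1/f\<close> contains \<open>1/f\<close> again, but only to order \<open>k\<close>.\<close>
  have inv: "Ck_on k (\<lambda>x. inverse (f x)) S"
    using Suc Ck_on_Suc_imp by blast
  note mult = Ck_on_bilinear[OF bounded_bilinear_mult \<open>open S\<close>]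
  show ?case
  proof (rule Ck_on_SucI[OF \<open>open S\<close>])
    show "((\<lambda>x. inverse (f x)) has_derivative
        (\<lambda>v. - 1 * (inverse (f x) * frechet_derivative f (at x) v * inverse (f x)))) (at x)"
      if "x \<in> S" for x
      using Deriv.has_derivative_inverse[OF Suc.prems(3)[OF that] Ck_on_SucD[OF Suc.prems(2) that]]
      by simp
    show "Ck_on k (\<lambda>x. - 1 * (inverse (f x) * frechet_derivative f (at x) v * inverse (f x))) S"
      for v
      by (intro mult inv Ck_on_const) (use Suc.prems in auto)
  qed
qed

lemma smooth_on_subset: "smooth_on f S \<Longrightarrow> T \<subseteq> S \<Longrightarrow> smooth_on f T"
  by (auto simp: smooth_on_def intro: Ck_on_subset)

lemma smooth_on_cong:
  "open S \<Longrightarrow> (\<And>x. x \<in> S \<Longrightarrow> f x = g x) \<Longrightarrow> smooth_on f S \<Longrightarrow> smooth_on g S"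
  unfolding smooth_on_def using Ck_on_cong by blast

lemma smooth_on_local:
  assumes "\<And>x. x \<in> S \<Longrightarrow> \<exists>U. open U \<and> x \<in> U \<and> smooth_on f U"
  shows "smooth_on f S"
  unfolding smooth_on_def
proof
  show "Ck_on k f S" for k
    by (rule Ck_on_local) (use assms in \<open>auto simp: smooth_on_def\<close>)
qed

lemma smooth_on_const: "smooth_on (\<lambda>x. c) S"
  by (simp add: smooth_on_def Ck_on_const)

lemma smooth_on_add:
  "open S \<Longrightarrow> smooth_on f S \<Longrightarrow> smooth_on g S \<Longrightarrow> smooth_on (\<lambda>x. f x + g x) S"
  by (simp add: smooth_on_def Ck_on_add)

lemma smooth_on_bilinear:
  "bounded_bilinear b \<Longrightarrow> open S \<Longrightarrow> smooth_on f S \<Longrightarrow> smooth_on g S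
    \<Longrightarrow> smooth_on (\<lambda>x. b (f x) (g x)) S"
  by (simp add: smooth_on_def Ck_on_bilinear)

lemmas smooth_on_scaleR = smooth_on_bilinear[OF bounded_bilinear_scaleR]
lemmas smooth_on_mult = smooth_on_bilinear[OF bounded_bilinear_mult]
lemmas smooth_on_inner = smooth_on_bilinear[OF bounded_bilinear_inner]

lemma smooth_on_divide:
  fixes f g :: "'e::real_normed_vector \<Rightarrow> real"
  assumes "open S" "smooth_on f S" "smooth_on g S" "\<And>x. x \<in> S \<Longrightarrow> g x \<noteq> 0"
  shows "smooth_on (\<lambda>x. f x / g x) S"
  unfolding divide_inverse
  by (rule smooth_on_mult) (use assms in \<open>auto simp: smooth_on_def Ck_on_inverse\<close>)

lemma smooth_on_diff:
  fixes f g :: "'e::real_normed_vector \<Rightarrow> 'f::real_normed_vector"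
  assumes "open S" "smooth_on f S" "smooth_on g S"
  shows "smooth_on (\<lambda>x. f x - g x) S"
proof -
  have "smooth_on (\<lambda>x. f x + (- 1) *\<^sub>R g x) S"
    by (intro smooth_on_add smooth_on_scaleR smooth_on_const assms)
  then show ?thesis by simp
qed

lemma smooth_on_sum:
  assumes "open S" "\<And>i. i \<in> I \<Longrightarrow> smooth_on (f i) S"
  shows "smooth_on (\<lambda>x. \<Sum>i\<in>I. f i x) S"
  using assms
  by (induction I rule: infinite_finite_induct) (auto intro: smooth_on_const smooth_on_add)

text \<open>
  For a family of linear maps only the smoothness of the images of constant vectors is asked
  for, which is the form in which metrics, differentials and complex structures are given in
  charts. Expanding \<open>Y x\<close> in the standard basis reduces to that case.
\<close>

lemma smooth_on_linear_apply:
  fixes Y :: "'e::real_normed_vector \<Rightarrow> 'v::euclidean_space"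
    and T :: "'e \<Rightarrow> 'v \<Rightarrow> 'w::real_normed_vector"
  assumes "open S" and lin: "\<And>x. x \<in> S \<Longrightarrow> linear (T x)"
    and "\<And>v. smooth_on (\<lambda>x. T x v) S" and "smooth_on Y S"
  shows "smooth_on (\<lambda>x. T x (Y x)) S"
proof (rule smooth_on_cong[OF \<open>open S\<close>])
  show "smooth_on (\<lambda>x. \<Sum>b\<in>Basis. (Y x \<bullet> b) *\<^sub>R T x b) S"
    by (intro smooth_on_sum smooth_on_scaleR smooth_on_inner smooth_on_const assms)
  show "(\<Sum>b\<in>Basis. (Y x \<bullet> b) *\<^sub>R T x b) = T x (Y x)" if "x \<in> S" for x
  proof -
    have "T x (Y x) = T x (\<Sum>b\<in>Basis. (Y x \<bullet> b) *\<^sub>R b)"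
      by (simp add: euclidean_representation)
    also have "\<dots> = (\<Sum>b\<in>Basis. (Y x \<bullet> b) *\<^sub>R T x b)"
      by (simp add: linear_sum[OF lin[OF that]] linear_scale[OF lin[OF that]])
    finally show ?thesis by simp
  qed
qed

lemma smooth_on_has_derivative:
  assumes "smooth_on f S" "x \<in> S"
  shows "(f has_derivative frechet_derivative f (at x)) (at x)"
  using Ck_on_SucD[of 0 f S x] assms by (simp only: smooth_on_def)

lemma smooth_on_frechet_derivative:
  assumes "smooth_on f S"
  shows "smooth_on (\<lambda>x. frechet_derivative f (at x) v) S"
  using assms unfolding smooth_on_def by (metis Ck_on.simps(2))

section \<open>Smooth families of inner products\<close>

definition inner_form :: "('v::real_vector \<Rightarrow> 'v \<Rightarrow> real) \<Rightarrow> bool" where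
  "inner_form h \<longleftrightarrow>
     bilinear h \<and> (\<forall>v w. h v w = h w v) \<and> (\<forall>v. v \<noteq> 0 \<longrightarrow> h v v > 0)"

lemma inner_formD:
  assumes "inner_form h"
  shows "bilinear h" "h v w = h w v" "v \<noteq> 0 \<Longrightarrow> h v v > 0" "h v v = 0 \<Longrightarrow> v = 0"
    and "linear (h v)" "linear (\<lambda>w. h w v)"
  using assms by (auto simp: inner_form_def bilinear_def)

lemma smooth_on_bilinear_apply:
  fixes Y Z :: "'e::real_normed_vector \<Rightarrow> 'v::euclidean_space"
  assumes "open S" and G: "\<And>x. x \<in> S \<Longrightarrow> inner_form (G x)"
    and smG: "\<And>v w. smooth_on (\<lambda>x. G x v w) S" and "smooth_on Y S" "smooth_on Z S"
  shows "smooth_on (\<lambda>x. G x (Y x) (Z x)) S"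
proof (rule smooth_on_linear_apply[OF \<open>open S\<close> _ _ \<open>smooth_on Z S\<close>])
  show "linear (G x (Y x))" if "x \<in> S" for x by (rule inner_formD(5)[OF G[OF that]])
  show "smooth_on (\<lambda>x. G x (Y x) v) S" for v
    by (rule smooth_on_linear_apply[OF \<open>open S\<close> inner_formD(6)[OF G] smG \<open>smooth_on Y S\<close>])
qed

text \<open>
  This is Gram--Schmidt, arranged as an induction that produces representing vectors instead of
  orthogonal frames. Given the result for \<open>I\<close>, the representative \<open>q\<close> of \<open>G (X a)\<close> is the
  orthogonal projection of \<open>X a\<close> to the span of the \<open>X i\<close> with \<open>i \<in> I\<close>, so
  \<open>u = X a - q\<close> is orthogonal to this span and, by independence, nowhere zero. Adding the right
  multiple of \<open>u\<close> to the representative \<open>w\<close> for \<open>I\<close> corrects its product with \<open>X a\<close>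
  and leaves the other products alone. The only operation beyond sums and products is the
  division by \<open>G u u > 0\<close>, which keeps everything smooth in the parameter \<open>x\<close>.

  With \<open>\<alpha>\<close> the differential of a function it yields gradients, and with
  \<open>\<alpha> x = G x (Y x)\<close> the orthogonal projection of \<open>Y\<close>.
\<close>

lemma smooth_Riesz_representation:
  fixes G :: "'x::real_normed_vector \<Rightarrow> 'v::euclidean_space \<Rightarrow> 'v \<Rightarrow> real"
    and X :: "'i \<Rightarrow> 'x \<Rightarrow> 'v"
  assumes "finite I" and S: "open S"
    and G: "\<And>x. x \<in> S \<Longrightarrow> inner_form (G x)" and smG: "\<And>v w. smooth_on (\<lambda>x. G x v w) S"
    and "\<And>i. i \<in> I \<Longrightarrow> smooth_on (X i) S"
    and "\<And>x i. x \<in> S \<Longrightarrow> i \<in> I \<Longrightarrow> X i x \<notin> span ((\<lambda>j. X j x) ` (I - {i}))"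
    and "\<And>x. x \<in> S \<Longrightarrow> linear (\<alpha> x)" and "\<And>v. smooth_on (\<lambda>x. \<alpha> x v) S"
  shows "\<exists>w. smooth_on w S \<and> (\<forall>x\<in>S. w x \<in> span ((\<lambda>i. X i x) ` I) \<and>
           (\<forall>i\<in>I. G x (w x) (X i x) = \<alpha> x (X i x)))"
  using assms(1,5-)
proof (induction I arbitrary: \<alpha>)
  case empty
  show ?case by (rule exI[of _ "\<lambda>x. 0"]) (simp add: smooth_on_const)
next
  case (insert a I)
  have new: "X a x \<notin> span ((\<lambda>i. X i x) ` I)" if "x \<in> S" for x
    using insert.prems(2)[OF that, of a] insert.hyps(2) by simp
  have smX: "smooth_on (X a) S" using insert.prems(1) by auto
  have indep: "X i x \<notin> span ((\<lambda>j. X j x) ` (I - {i}))" if "x \<in> S" "i \<in> I" for x i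
    using insert.prems(2)[of x i] that span_mono[of "(\<lambda>j. X j x) ` (I - {i})"
        "(\<lambda>j. X j x) ` (insert a I - {i})"] by blast
  have IH: "\<exists>w. smooth_on w S \<and> (\<forall>x\<in>S. w x \<in> span ((\<lambda>i. X i x) ` I) \<and>
           (\<forall>i\<in>I. G x (w x) (X i x) = \<beta> x (X i x)))"
    if "\<And>x. x \<in> S \<Longrightarrow> linear (\<beta> x)" "\<And>v. smooth_on (\<lambda>x. \<beta> x v) S" for \<beta>
    by (rule insert.IH) (use insert.prems(1) indep that in auto)
  obtain w where w: "smooth_on w S" "\<And>x. x \<in> S \<Longrightarrow> w x \<in> span ((\<lambda>i. X i x) ` I)"
    "\<And>x i. x \<in> S \<Longrightarrow> i \<in> I \<Longrightarrow> G x (w x) (X i x) = \<alpha> x (X i x)"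
    using IH[OF insert.prems(3,4)] by auto
  obtain q where q: "smooth_on q S" "\<And>x. x \<in> S \<Longrightarrow> q x \<in> span ((\<lambda>i. X i x) ` I)"
    "\<And>x i. x \<in> S \<Longrightarrow> i \<in> I \<Longrightarrow> G x (q x) (X i x) = G x (X a x) (X i x)"
    using IH[of "\<lambda>x. G x (X a x)"] inner_formD(5)[OF G]
      smooth_on_bilinear_apply[OF S G smG smX smooth_on_const] by auto
  define u where "u x = X a x - q x" for x
  \<comment> \<open>The factor for which \<open>w + t u\<close> has the product \<open>\<alpha> (X a)\<close> with \<open>X a\<close>.\<close>
  define t where "t x = (\<alpha> x (X a x) - G x (w x) (X a x)) / G x (u x) (u x)" for x
  have smu: "smooth_on u S" unfolding u_def by (intro smooth_on_diff S smX q)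
  have pos: "G x (u x) (u x) > 0" if "x \<in> S" for x
  proof (rule inner_formD(3)[OF G[OF that]])
    show "u x \<noteq> 0" using new[OF that] q(2)[OF that] by (auto simp: u_def)
  qed
  have orth: "G x (u x) (X i x) = 0" if "x \<in> S" "i \<in> I" for x i
    using q(3)[OF that] bilinear_lsub[OF inner_formD(1)[OF G[OF that(1)]]] unfolding u_def by simp
  have orth': "G x (u x) v = 0" if "x \<in> S" "v \<in> span ((\<lambda>i. X i x) ` I)" for x v
    by (rule real_vector.linear_eq_0_on_span[OF inner_formD(5)[OF G[OF that(1)]] _ that(2)])
      (use orth that in auto)
  have self: "G x (u x) (X a x) = G x (u x) (u x)" if "x \<in> S" for x
  proof -
    have "G x (u x) (u x) = G x (u x) (X a x) - G x (u x) (q x)"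
      unfolding u_def[of x]
      by (rule bilinear_rsub[OF inner_formD(1)[OF G[OF that]]])
    then show ?thesis using orth'[OF that q(2)[OF that]] by simp
  qed
  let ?w = "\<lambda>x. w x + t x *\<^sub>R u x"
  have "smooth_on (\<lambda>x. \<alpha> x (X a x)) S"
    by (rule smooth_on_linear_apply[OF S insert.prems(3,4) smX])
  moreover note smooth_on_bilinear_apply[OF S G smG w(1) smX]
    smooth_on_bilinear_apply[OF S G smG smu smu]
  moreover have "G x (u x) (u x) \<noteq> 0" if "x \<in> S" for x
    using pos[OF that] by simp
  ultimately have "smooth_on t S"
    unfolding t_def by (intro smooth_on_divide smooth_on_diff S)
  then have "smooth_on ?w S" by (intro smooth_on_add smooth_on_scaleR S w smu)
  moreover have "?w x \<in> span ((\<lambda>i. X i x) ` insert a I)" if "x \<in> S" for x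
  proof -
    have "span ((\<lambda>i. X i x) ` I) \<subseteq> span ((\<lambda>i. X i x) ` insert a I)"
      by (intro span_mono) auto
    moreover have "X a x \<in> span ((\<lambda>i. X i x) ` insert a I)"
      by (intro span_base) auto
    ultimately show ?thesis using w(2)[OF that] q(2)[OF that] unfolding u_def
      by (intro span_add span_mul span_diff) auto
  qed
  moreover have "G x (?w x) (X i x) = \<alpha> x (X i x)" if "x \<in> S" "i \<in> insert a I" for x i
  proof -
    have "G x (?w x) (X i x) = G x (w x) (X i x) + t x * G x (u x) (X i x)"
      using inner_formD(1)[OF G[OF that(1)]] by (simp add: bilinear_ladd bilinear_lmul)
    then show ?thesis
      using that w(3) orth self pos[OF that(1)] by (auto simp: t_def)
  qed
  ultimately show ?case by (intro exI[of _ ?w]) blast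
qed

section \<open>Changes of charts\<close>

lemma chart_inv_chart_fun:
  assumes "is_chart c" "p \<in> chart_dom c"
  shows "chart_inv c (chart_fun c p) = p"
  using assms by (auto simp: is_chart_def homeomorphism_def)

lemma open_chart_image:
  assumes "is_chart c" "open U"
  shows "open (chart_fun c ` (chart_dom c \<inter> U))"
proof -
  have "openin (top_of_set (chart_fun c ` chart_dom c)) (chart_fun c ` (chart_dom c \<inter> U))"
    using assms by (intro homeomorphism_imp_open_map[of _ _ _ "chart_inv c"])
      (auto simp: is_chart_def)
  then show ?thesis
    using assms(1) openin_open_eq unfolding is_chart_def by blast
qed

text \<open>
  The Jacobian of a change of charts at a point. Both \<open>to_chart\<close> and \<open>from_chart\<close> are
  instances, so that they are mutually inverse is one case of the cocycle law
  \<open>transition_trans\<close>.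
\<close>

definition transition ::
  "('a, 'e::euclidean_space) chart \<Rightarrow> ('a, 'e) chart \<Rightarrow> 'a \<Rightarrow> 'e \<Rightarrow> 'e" where
  "transition c d p = frechet_derivative (chart_fun d \<circ> chart_inv c) (at (chart_fun c p))"

lemma to_chart_eq_transition: "to_chart A c p = transition (chart_at A p) c p"
  by (simp add: to_chart_def transition_def)

lemma from_chart_eq_transition: "from_chart A c p = transition c (chart_at A p) p"
  by (simp add: from_chart_def transition_def)

lemma manifold_chart:
  assumes "smooth_manifold A" "c \<in> A"
  shows "is_chart c"
  using assms by (simp add: smooth_manifold_def)

lemma chart_at_works:
  assumes "smooth_manifold A"
  shows "chart_at A p \<in> A" "p \<in> chart_dom (chart_at A p)"
proof -
  have "\<exists>c. c \<in> A \<and> p \<in> chart_dom c"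
    using assms unfolding smooth_manifold_def by blast
  from someI_ex[OF this] show "chart_at A p \<in> A" "p \<in> chart_dom (chart_at A p)"
    by (auto simp: chart_at_def)
qed

lemma transition_has_derivative:
  assumes "smooth_manifold A" "c \<in> A" "d \<in> A" "p \<in> chart_dom c" "p \<in> chart_dom d"
  shows "((chart_fun d \<circ> chart_inv c) has_derivative transition c d p) (at (chart_fun c p))"
proof -
  have "smooth_on (chart_fun d \<circ> chart_inv c) (chart_fun c ` (chart_dom c \<inter> chart_dom d))"
    using assms(1-3) by (simp add: smooth_manifold_def)
  then show ?thesis
    unfolding transition_def by (rule smooth_on_has_derivative) (use assms(4,5) in simp)
qed

lemma transition_trans:
  assumes A: "smooth_manifold A" and "c \<in> A" "d \<in> A" "e \<in> A"
    and p: "p \<in> chart_dom c" "p \<in> chart_dom d" "p \<in> chart_dom e"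
  shows "transition d e p (transition c d p v) = transition c e p v"
proof -
  let ?x = "chart_fun c p"
  note c = manifold_chart[OF A \<open>c \<in> A\<close>] and d = manifold_chart[OF A \<open>d \<in> A\<close>]
  have x: "(chart_fun d \<circ> chart_inv c) ?x = chart_fun d p"
    by (simp add: chart_inv_chart_fun[OF c p(1)])
  have "((chart_fun e \<circ> chart_inv d) \<circ> (chart_fun d \<circ> chart_inv c)
      has_derivative transition d e p \<circ> transition c d p) (at ?x)"
  proof (rule diff_chain_at)
    show "((chart_fun d \<circ> chart_inv c) has_derivative transition c d p) (at ?x)"
      by (rule transition_has_derivative[OF A assms(2,3) p(1,2)])
    show "((chart_fun e \<circ> chart_inv d) has_derivative transition d e p)
        (at ((chart_fun d \<circ> chart_inv c) ?x))"
      unfolding x by (rule transition_has_derivative[OF A assms(3,4) p(2,3)])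
  qed
  then have "((chart_fun e \<circ> chart_inv c)
      has_derivative transition d e p \<circ> transition c d p) (at ?x)"
  proof (rule has_derivative_transform_within_open)
    show "open (chart_fun c ` (chart_dom c \<inter> chart_dom d))"
      using d by (intro open_chart_image c) (simp add: is_chart_def)
  qed (use p in \<open>auto simp: chart_inv_chart_fun c d\<close>)
  from frechet_derivative_at[OF this] show ?thesis
    by (metis comp_apply transition_def)
qed

lemma transition_refl:
  assumes c: "is_chart c" and p: "p \<in> chart_dom c"
  shows "transition c c p v = v"
proof -
  have "((chart_fun c \<circ> chart_inv c) has_derivative (\<lambda>v. v)) (at (chart_fun c p))"
  proof (rule has_derivative_transform_within_open[OF has_derivative_ident])
    show "open (chart_fun c ` chart_dom c)" using c by (simp add: is_chart_def)
  qed (use p in \<open>auto simp: chart_inv_chart_fun c\<close>)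
  from frechet_derivative_at[OF this] show ?thesis
    by (simp add: transition_def fun_eq_iff)
qed

lemma from_chart_to_chart:
  assumes "smooth_manifold A" "c \<in> A" "p \<in> chart_dom c"
  shows "from_chart A c p (to_chart A c p v) = v"
  using assms chart_at_works[OF assms(1), of p]
  by (simp add: to_chart_eq_transition from_chart_eq_transition transition_trans[of A]
      transition_refl[OF manifold_chart[of A]])

lemma to_chart_from_chart:
  assumes "smooth_manifold A" "c \<in> A" "p \<in> chart_dom c"
  shows "to_chart A c p (from_chart A c p v) = v"
  using assms chart_at_works[OF assms(1), of p]
  by (simp add: to_chart_eq_transition from_chart_eq_transition transition_trans[of A]
      transition_refl[OF manifold_chart[of A]])

lemma linear_transition:
  assumes "smooth_manifold A" "c \<in> A" "d \<in> A" "p \<in> chart_dom c" "p \<in> chart_dom d"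
  shows "linear (transition c d p)"
  by (rule has_derivative_linear[OF transition_has_derivative[OF assms]])

lemma
  assumes "smooth_manifold A" "c \<in> A" "p \<in> chart_dom c"
  shows linear_to_chart: "linear (to_chart A c p)"
    and linear_from_chart: "linear (from_chart A c p)"
  using assms chart_at_works[OF assms(1), of p] linear_transition
  by (simp_all add: to_chart_eq_transition from_chart_eq_transition linear_transition[of A])

lemma smooth_map_has_derivative:
  assumes F: "smooth_map A B F" and "c \<in> A" "d \<in> B" "p \<in> chart_dom c" "F p \<in> chart_dom d"
  shows "((chart_fun d \<circ> F \<circ> chart_inv c) has_derivative
      frechet_derivative (chart_fun d \<circ> F \<circ> chart_inv c) (at (chart_fun c p))) (at (chart_fun c p))"
proof -
  have "smooth_on (chart_fun d \<circ> F \<circ> chart_inv c)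
      (chart_fun c ` (chart_dom c \<inter> F -` chart_dom d))"
    using assms(1-3) by (simp add: smooth_map_def)
  then show ?thesis
    by (rule smooth_on_has_derivative) (use assms(4,5) in simp)
qed

lemma open_vimage_chart_dom:
  assumes "smooth_map A B F" "is_chart d"
  shows "open (F -` chart_dom d)"
  using assms by (auto simp: smooth_map_def is_chart_def intro: open_vimage)

text \<open>
  The differential is defined by preferred charts, which jump from point to point. Near a given
  point it can be read off in any two fixed charts instead, where it depends smoothly on the
  point.
\<close>

lemma differential_in_charts:
  assumes A: "smooth_manifold A" and B: "smooth_manifold B" and F: "smooth_map A B F"
    and c: "c \<in> A" "p \<in> chart_dom c" and d: "d \<in> B" "F p \<in> chart_dom d"
  shows "differential A B F p v = from_chart B d (F p)
      (frechet_derivative (chart_fun d \<circ> F \<circ> chart_inv c) (at (chart_fun c p)) (to_chart A c p v))"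
proof -
  let ?c = "chart_at A p" and ?d = "chart_at B (F p)" and ?f = "chart_fun d \<circ> F \<circ> chart_inv c"
  let ?x = "chart_fun ?c p"
  let ?L = "frechet_derivative ?f (at (chart_fun c p))"
  note c' = chart_at_works[OF A, of p] and d' = chart_at_works[OF B, of "F p"]
  note charts = manifold_chart[OF A c(1)] manifold_chart[OF A c'(1)]
    manifold_chart[OF B d(1)] manifold_chart[OF B d'(1)]
  have x: "(chart_fun c \<circ> chart_inv ?c) ?x = chart_fun c p"
    by (simp add: chart_inv_chart_fun charts c')
  have y: "(?f \<circ> (chart_fun c \<circ> chart_inv ?c)) ?x = chart_fun d (F p)"
    by (simp add: chart_inv_chart_fun charts c c')
  have "(?f has_derivative ?L) (at ((chart_fun c \<circ> chart_inv ?c) ?x))"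
    unfolding x by (rule smooth_map_has_derivative[OF F c(1) d(1) c(2) d(2)])
  then have "(?f \<circ> (chart_fun c \<circ> chart_inv ?c) has_derivative ?L \<circ> to_chart A c p) (at ?x)"
    unfolding to_chart_eq_transition
    by (intro diff_chain_at transition_has_derivative[OF A c'(1) c(1) c'(2) c(2)])
  moreover have "((chart_fun ?d \<circ> chart_inv d) has_derivative from_chart B d (F p))
      (at ((?f \<circ> (chart_fun c \<circ> chart_inv ?c)) ?x))"
    unfolding y from_chart_eq_transition
    by (rule transition_has_derivative[OF B d(1) d'(1) d(2) d'(2)])
  ultimately have "((chart_fun ?d \<circ> chart_inv d) \<circ> (?f \<circ> (chart_fun c \<circ> chart_inv ?c))
      has_derivative from_chart B d (F p) \<circ> (?L \<circ> to_chart A c p)) (at ?x)"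
    by (rule diff_chain_at)
  then have "((chart_fun ?d \<circ> F \<circ> chart_inv ?c)
      has_derivative from_chart B d (F p) \<circ> (?L \<circ> to_chart A c p)) (at ?x)"
  proof (rule has_derivative_transform_within_open)
    show "open (chart_fun ?c ` (chart_dom ?c \<inter> (chart_dom c \<inter> F -` chart_dom d)))"
      using charts by (intro open_chart_image open_Int open_vimage_chart_dom[OF F])
        (auto simp: is_chart_def)
  qed (use c c' d in \<open>auto simp: chart_inv_chart_fun charts\<close>)
  from frechet_derivative_at[OF this] show ?thesis
    by (metis comp_apply differential_def)
qed

lemma smooth_vfield_diff:
  assumes A: "smooth_manifold A" and X: "smooth_vfield A X" and Y: "smooth_vfield A Y"
  shows "smooth_vfield A (\<lambda>p. X p - Y p)"
  unfolding smooth_vfield_on_def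
proof
  fix c assume c: "c \<in> A"
  let ?S = "chart_fun c ` (chart_dom c \<inter> UNIV)"
  note ch = manifold_chart[OF A c]
  have S: "open ?S" by (intro open_chart_image ch) simp
  show "smooth_on (\<lambda>x. to_chart A c (chart_inv c x) (X (chart_inv c x) - Y (chart_inv c x))) ?S"
  proof (rule smooth_on_cong[OF S _ smooth_on_diff[OF S]])
    show "smooth_on (\<lambda>x. to_chart A c (chart_inv c x) (X (chart_inv c x))) ?S"
      "smooth_on (\<lambda>x. to_chart A c (chart_inv c x) (Y (chart_inv c x))) ?S"
      using X Y c by (auto simp: smooth_vfield_on_def)
  qed (auto simp: chart_inv_chart_fun ch linear_diff[OF linear_to_chart[OF A c]])
qed

lemma smooth_vfield_zero:
  assumes A: "smooth_manifold A"
  shows "smooth_vfield A (\<lambda>p. 0)"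
  unfolding smooth_vfield_on_def
proof
  fix c assume c: "c \<in> A"
  note ch = manifold_chart[OF A c]
  show "smooth_on (\<lambda>x. to_chart A c (chart_inv c x) 0) (chart_fun c ` (chart_dom c \<inter> UNIV))"
    by (rule smooth_on_cong[OF open_chart_image[OF ch] _ smooth_on_const[of 0]])
      (auto simp: chart_inv_chart_fun ch linear_0[OF linear_to_chart[OF A c]])
qed

lemma smooth_vfield_endomorphism:
  assumes A: "smooth_manifold A" and lin: "\<And>p. linear (T p)"
    and T: "\<And>c v. c \<in> A \<Longrightarrow> smooth_vfield_on A (chart_dom c) (\<lambda>p. T p (from_chart A c p v))"
    and X: "smooth_vfield A X"
  shows "smooth_vfield A (\<lambda>p. T p (X p))"
  unfolding smooth_vfield_on_def
proof
  fix c assume c: "c \<in> A"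
  let ?S = "chart_fun c ` (chart_dom c \<inter> UNIV)"
  let ?T = "\<lambda>x v. to_chart A c (chart_inv c x) (T (chart_inv c x) (from_chart A c (chart_inv c x) v))"
  let ?Y = "\<lambda>x. to_chart A c (chart_inv c x) (X (chart_inv c x))"
  note ch = manifold_chart[OF A c]
  have S: "open ?S" by (intro open_chart_image ch) simp
  have "smooth_on (\<lambda>x. ?T x (?Y x)) ?S"
  proof (rule smooth_on_linear_apply[where T = ?T and Y = ?Y, OF S])
    show "linear (?T x)" if "x \<in> ?S" for x
    proof -
      have p: "chart_inv c x \<in> chart_dom c" using that by (auto simp: chart_inv_chart_fun ch)
      show ?thesis
        using linear_compose[OF linear_compose[OF linear_from_chart[OF A c p] lin]
            linear_to_chart[OF A c p]]
        by (simp add: o_def)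
    qed
    show "smooth_on (\<lambda>x. ?T x v) ?S" for v
      using bspec[OF T[OF c, unfolded smooth_vfield_on_def] c] by simp
    show "smooth_on ?Y ?S" using X c by (auto simp: smooth_vfield_on_def)
  qed
  then show "smooth_on (\<lambda>x. to_chart A c (chart_inv c x) (T (chart_inv c x) (X (chart_inv c x)))) ?S"
    by (rule smooth_on_cong[OF S, rotated])
      (auto simp: chart_inv_chart_fun ch from_chart_to_chart[OF A c])
qed

section \<open>Horizontal and vertical parts of smooth vector fields\<close>

lemma metric_inner_form: "riemannian_manifold A g \<Longrightarrow> inner_form (g p)"
  by (simp add: riemannian_manifold_def inner_form_def)

lemma orth_proj_eqI:
  assumes g: "inner_form (g p)" and D: "subspace (D p)"
    and w: "w \<in> D p" "\<And>u. u \<in> D p \<Longrightarrow> g p (X p - w) u = 0"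
  shows "orth_proj g D X p = w"
  unfolding orth_proj_def
proof (rule the_equality)
  fix w' assume w': "w' \<in> D p \<and> (\<forall>u\<in>D p. g p (X p - w') u = 0)"
  let ?u = "w' - w"
  have u: "?u \<in> D p" using D w(1) w' by (simp add: subspace_diff)
  have "g p ?u ?u = g p ((X p - w) - (X p - w')) ?u" by (simp add: algebra_simps)
  also have "\<dots> = g p (X p - w) ?u - g p (X p - w') ?u"
    by (rule bilinear_lsub[OF inner_formD(1)[OF g]])
  also have "\<dots> = 0" using w(2)[OF u] w' u by simp
  finally show "w' = w" using inner_formD(4)[OF g, of ?u] by simp
qed (use w in auto)

locale metric_submersion =
  fixes A :: "('a::{t2_space,second_countable_topology}, 'e::euclidean_space) chart set"
    and g :: "'a \<Rightarrow> 'e \<Rightarrow> 'e \<Rightarrow> real"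
    and B :: "('b::{t2_space,second_countable_topology}, 'f::euclidean_space) chart set"
    and g2 :: "'b \<Rightarrow> 'f \<Rightarrow> 'f \<Rightarrow> real"
    and F :: "'a \<Rightarrow> 'b"
  assumes submersion: "riemannian_submersion A g B g2 F"
begin

abbreviation "V \<equiv> vert A B F"
abbreviation "H \<equiv> hor A g B F"
abbreviation "PV \<equiv> V_proj A g B F"
abbreviation "PH \<equiv> H_proj A g B F"

lemma
  shows manifold_A: "smooth_manifold A" and manifold_B: "smooth_manifold B"
    and smooth_F: "smooth_map A B F"
    and inner: "inner_form (g p)"
  using submersion metric_inner_form
  by (auto simp: riemannian_submersion_def riemannian_manifold_def)

lemmas g_bilinear = inner_formD(1)[OF inner]
lemmas g_linear = inner_formD(5)[OF inner] inner_formD(6)[OF inner]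

lemma linear_differential: "linear (differential A B F p)"
proof -
  note ch = chart_at_works[OF manifold_A, of p] chart_at_works[OF manifold_B, of "F p"]
  show ?thesis
    unfolding differential_def
    by (rule has_derivative_linear[OF smooth_map_has_derivative[OF smooth_F ch(1,3,2,4)]])
qed

lemma surj_differential: "surj (differential A B F p)"
proof -
  have "subspace (range (differential A B F p))"
    by (rule linear_subspace_image[OF linear_differential subspace_UNIV])
  moreover have "dim (range (differential A B F p)) = DIM('f)"
    using submersion by (simp add: riemannian_submersion_def)
  ultimately show ?thesis by (metis dim_eq_full span_eq_iff)
qed

lemma subspace_V: "subspace (V p)"
  unfolding vert_def by (rule linear_subspace_kernel[OF linear_differential])

lemma mem_H_iff: "v \<in> H p \<longleftrightarrow> (\<forall>w\<in>V p. g p v w = 0)"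
  by (simp add: hor_def orth_in_def)

lemma subspace_H: "subspace (H p)"
  unfolding subspace_def
  by (auto simp: mem_H_iff bilinear_ladd[OF g_bilinear] bilinear_lmul[OF g_bilinear]
      bilinear_lzero[OF g_bilinear])

lemma H_V_orth: "h \<in> H p \<Longrightarrow> v \<in> V p \<Longrightarrow> g p h v = 0" "h \<in> H p \<Longrightarrow> v \<in> V p \<Longrightarrow> g p v h = 0"
  using inner_formD(2)[OF inner] by (auto simp: mem_H_iff)

text \<open>
  In charts \<open>c\<close> and \<open>d\<close> the map becomes a submersion \<open>\<phi>\<close> between open sets of
  Euclidean spaces, with derivative \<open>L\<close>. A vector is vertical iff all components
  \<open>L v \<bullet> b\<close> vanish, i.e. iff it is orthogonal to the gradients \<open>n b\<close> of the components of
  \<open>\<phi>\<close>; hence the gradients span the horizontal space. They are smooth, by the Riesz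
  representation with respect to the constant frame \<open>Basis\<close>, and independent, because
  \<open>L\<close> is onto. A second Riesz representation, now with respect to the gradients, is the
  orthogonal projection of \<open>X\<close> to the horizontal space. This also proves that the horizontal
  part exists at every point.
\<close>

lemma smooth_horizontal_part_in_chart:
  assumes X: "smooth_vfield A X" and c: "c \<in> A" "p0 \<in> chart_dom c"
  shows "\<exists>U w. open U \<and> p0 \<in> U \<and> U \<subseteq> chart_dom c \<and> smooth_on w (chart_fun c ` U) \<and>
     (\<forall>p\<in>U. from_chart A c p (w (chart_fun c p)) \<in> H p \<and>
             X p - from_chart A c p (w (chart_fun c p)) \<in> V p)"
proof -
  let ?d = "chart_at B (F p0)"
  note d = chart_at_works[OF manifold_B, of "F p0"]
  note cc = manifold_chart[OF manifold_A c(1)] and dd = manifold_chart[OF manifold_B d(1)]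
  define U where "U = chart_dom c \<inter> F -` chart_dom ?d"
  define S where "S = chart_fun c ` U"
  define \<phi> where "\<phi> = chart_fun ?d \<circ> F \<circ> chart_inv c"
  define L where "L x = frechet_derivative \<phi> (at x)" for x
  define G where
    "G x v w = (let p = chart_inv c x in g p (from_chart A c p v) (from_chart A c p w))" for x v w
  define Y where "Y x = to_chart A c (chart_inv c x) (X (chart_inv c x))" for x
  have U: "open U" "U \<subseteq> chart_dom c" "p0 \<in> U"
    unfolding U_def using cc open_vimage_chart_dom[OF smooth_F dd] c(2) d(2) by (auto simp: is_chart_def)
  have S: "open S"
    unfolding S_def U_def by (intro open_chart_image cc open_vimage_chart_dom[OF smooth_F dd])
  have inv: "chart_inv c x \<in> U" "chart_inv c x \<in> chart_dom c" "chart_fun c (chart_inv c x) = x"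
    if "x \<in> S" for x
    using that U(2) by (auto simp: S_def chart_inv_chart_fun[OF cc] subset_iff)
  have sub: "S \<subseteq> chart_fun c ` chart_dom c" unfolding S_def using U(2) by auto
  have smY: "smooth_on Y S"
    using X c(1) unfolding smooth_vfield_on_def Y_def Int_UNIV_right
    by (blast intro: smooth_on_subset[OF _ sub])
  have smG: "smooth_on (\<lambda>x. G x v w) S" for v w
    using submersion c(1) smooth_on_subset[OF _ sub]
    unfolding riemannian_submersion_def riemannian_manifold_def G_def by blast
  have sm\<phi>: "smooth_on \<phi> S"
    using smooth_F c(1) d(1) unfolding smooth_map_def \<phi>_def S_def U_def by blast
  have smL: "smooth_on (\<lambda>x. L x v) S" for v
    unfolding L_def by (rule smooth_on_frechet_derivative[OF sm\<phi>])
  have linL: "linear (L x)" if "x \<in> S" for x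
    unfolding L_def by (rule has_derivative_linear[OF smooth_on_has_derivative[OF sm\<phi> that]])
  have diffL: "differential A B F (chart_inv c x) v
      = from_chart B ?d (F (chart_inv c x)) (L x (to_chart A c (chart_inv c x) v))"
    if "x \<in> S" for x v
    using differential_in_charts[OF manifold_A manifold_B smooth_F c(1) inv(2)[OF that] d(1)]
      inv(1,3)[OF that]
    by (simp add: L_def \<phi>_def U_def)
  have inj_d: "from_chart B ?d (F (chart_inv c x)) z = from_chart B ?d (F (chart_inv c x)) z'
      \<Longrightarrow> z = z'" if "x \<in> S" for x z z'
    using to_chart_from_chart[OF manifold_B d(1)] inv(1)[OF that] by (metis U_def IntD2 vimageD)
  have inj_c: "from_chart A c (chart_inv c x) v = 0 \<longleftrightarrow> v = 0" if "x \<in> S" for x v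
    using to_chart_from_chart[OF manifold_A c(1) inv(2)[OF that]]
      linear_0[OF linear_to_chart[OF manifold_A c(1) inv(2)[OF that]]]
      linear_0[OF linear_from_chart[OF manifold_A c(1) inv(2)[OF that]]] by metis
  have vertL: "from_chart A c (chart_inv c x) v \<in> V (chart_inv c x) \<longleftrightarrow> L x v = 0"
    if "x \<in> S" for x v
  proof -
    have "F (chart_inv c x) \<in> chart_dom ?d" using inv(1)[OF that] by (simp add: U_def)
    from linear_0[OF linear_from_chart[OF manifold_B d(1) this]] show ?thesis
      unfolding vert_def mem_Collect_eq diffL[OF that]
        to_chart_from_chart[OF manifold_A c(1) inv(2)[OF that]]
      by (metis inj_d[OF that])
  qed
  have surjL: "\<exists>v. L x v = z" if "x \<in> S" for x z
    using surjD[OF surj_differential] diffL[OF that] inj_d[OF that] by metis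
  have G: "inner_form (G x)" if "x \<in> S" for x
  proof -
    note lin = linear_from_chart[OF manifold_A c(1) inv(2)[OF that]]
    note lin1 = linear_compose[OF lin g_linear(1), unfolded o_def]
      and lin2 = linear_compose[OF lin g_linear(2), unfolded o_def]
    show ?thesis
      unfolding inner_form_def bilinear_def G_def Let_def
      using lin1 lin2 inner_formD(2,3)[OF inner] inj_c[OF that] by blast
  qed
  have linLb: "linear (\<lambda>v. L x v \<bullet> b)" if "x \<in> S" for x b
    using linear_compose[OF linL[OF that] bounded_linear.linear[OF bounded_linear_inner_left]]
    by (simp add: o_def)
  have smLb: "smooth_on (\<lambda>x. L x v \<bullet> b) S" for v b
    by (intro smooth_on_inner S smL smooth_on_const)
  have "\<exists>n. smooth_on n S \<and> (\<forall>x\<in>S. \<forall>v. G x (n x) v = L x v \<bullet> b)" for b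
  proof -
    have "\<exists>n. smooth_on n S \<and> (\<forall>x\<in>S. n x \<in> span ((\<lambda>i. i) ` Basis) \<and>
            (\<forall>i\<in>Basis. G x (n x) i = L x i \<bullet> b))"
      using independent_Basis unfolding dependent_def
      by (intro smooth_Riesz_representation[where X = "\<lambda>i x. i"] S G smG linLb smLb
          smooth_on_const) auto
    then obtain n where n: "smooth_on n S" "\<And>x i. x \<in> S \<Longrightarrow> i \<in> Basis \<Longrightarrow> G x (n x) i = L x i \<bullet> b"
      by blast
    have "G x (n x) v = L x v \<bullet> b" if "x \<in> S" for x v
      by (rule linear_eq_on_span[OF inner_formD(5)[OF G[OF that]] linLb[OF that], of Basis])
        (use n(2)[OF that] in auto)
    then show ?thesis using n(1) by blast
  qed
  then obtain n where n: "\<And>b. smooth_on (n b) S"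
    "\<And>b x v. x \<in> S \<Longrightarrow> G x (n b x) v = L x v \<bullet> b"
    by metis
  have n': "G x v (n b x) = L x v \<bullet> b" if "x \<in> S" for x v b
    using n(2)[OF that] inner_formD(2)[OF G[OF that]] by metis
  have indep: "n b x \<notin> span ((\<lambda>b. n b x) ` (Basis - {b}))" if x: "x \<in> S" and b: "b \<in> Basis" for x b
  proof
    assume *: "n b x \<in> span ((\<lambda>b. n b x) ` (Basis - {b}))"
    \<comment> \<open>A vector on which only the component \<open>b\<close> of \<open>L\<close> is nonzero separates \<open>n b\<close> from the rest.\<close>
    obtain v where v: "L x v = b" using surjL[OF x] by blast
    have "G x v (n b x) = 0"
      by (rule real_vector.linear_eq_0_on_span[OF inner_formD(5)[OF G[OF x]] _ *])
        (use n'[OF x] b v in \<open>auto simp: inner_Basis split: if_splits\<close>)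
    then show False using n'[OF x] v b by simp
  qed
  have "\<exists>w. smooth_on w S \<and> (\<forall>x\<in>S. w x \<in> span ((\<lambda>b. n b x) ` Basis) \<and>
      (\<forall>b\<in>Basis. G x (w x) (n b x) = G x (Y x) (n b x)))"
    by (rule smooth_Riesz_representation[OF _ S G smG n(1) indep inner_formD(5)[OF G]
          smooth_on_bilinear_apply[OF S G smG smY smooth_on_const]]) auto
  then obtain w where w: "smooth_on w S" "\<And>x. x \<in> S \<Longrightarrow> w x \<in> span ((\<lambda>b. n b x) ` Basis)"
    "\<And>x b. x \<in> S \<Longrightarrow> b \<in> Basis \<Longrightarrow> G x (w x) (n b x) = G x (Y x) (n b x)"
    by blast
  have "from_chart A c p (w (chart_fun c p)) \<in> H p \<and>
        X p - from_chart A c p (w (chart_fun c p)) \<in> V p" if "p \<in> U" for p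
  proof
    define x where "x = chart_fun c p"
    have x: "x \<in> S" using that by (auto simp: x_def S_def)
    have p: "chart_inv c x = p" "p \<in> chart_dom c"
      using that U(2) chart_inv_chart_fun[OF cc] by (auto simp: x_def)
    note ft = from_chart_to_chart[OF manifold_A c(1) p(2)]
    show "from_chart A c p (w (chart_fun c p)) \<in> H p"
      unfolding mem_H_iff
    proof
      fix u assume u: "u \<in> V p"
      have 0: "L x (to_chart A c p u) = 0"
        using vertL[OF x, of "to_chart A c p u"] u by (simp add: p ft)
      have "G x (w x) (to_chart A c p u) = 0"
        by (rule real_vector.linear_eq_0_on_span[OF inner_formD(6)[OF G[OF x]] _ w(2)[OF x]])
          (use n(2)[OF x] 0 in auto)
      then show "g p (from_chart A c p (w (chart_fun c p))) u = 0"
        by (simp add: G_def p ft x_def[symmetric])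
    qed
    have "L x (Y x - w x) = 0"
    proof (rule euclidean_eqI)
      fix b :: 'f assume b: "b \<in> Basis"
      have "L x (Y x - w x) \<bullet> b = G x (Y x - w x) (n b x)" by (simp add: n'[OF x])
      also have "\<dots> = 0"
        using w(3)[OF x b] by (simp add: bilinear_lsub[OF inner_formD(1)[OF G[OF x]]])
      finally show "L x (Y x - w x) \<bullet> b = 0 \<bullet> b" by simp
    qed
    then have "from_chart A c p (Y x - w x) \<in> V p"
      using vertL[OF x, of "Y x - w x"] by (simp only: p)
    then show "X p - from_chart A c p (w (chart_fun c p)) \<in> V p"
      by (simp add: linear_diff[OF linear_from_chart[OF manifold_A c(1) p(2)]] Y_def p ft x_def[symmetric])
  qed
  then show ?thesis using U w(1) unfolding S_def by blast
qed

lemma PH_eqI: "h \<in> H p \<Longrightarrow> X p - h \<in> V p \<Longrightarrow> PH X p = h"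
  unfolding H_proj_def by (rule orth_proj_eqI[where g = g and D = H, OF inner subspace_H])
    (auto intro: H_V_orth)

lemma PV_eqI: "v \<in> V p \<Longrightarrow> X p - v \<in> H p \<Longrightarrow> PV X p = v"
  unfolding V_proj_def by (rule orth_proj_eqI[where g = g and D = V, OF inner subspace_V])
    (auto intro: H_V_orth)

lemma
  assumes X: "smooth_vfield A X"
  shows PH_mem: "PH X p \<in> H p" and PV_mem: "PV X p \<in> V p" and PV_eq: "PV X p = X p - PH X p"
proof -
  note c = chart_at_works[OF manifold_A, of p]
  obtain h where h: "h \<in> H p" "X p - h \<in> V p"
    using smooth_horizontal_part_in_chart[OF X c] by blast
  have "PH X p = h" by (rule PH_eqI[where X = X, OF h])
  moreover have "PV X p = X p - h" by (rule PV_eqI[where X = X, OF h(2)]) (simp add: h)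
  ultimately show "PH X p \<in> H p" "PV X p \<in> V p" "PV X p = X p - PH X p" using h by simp_all
qed

lemma smooth_PH:
  assumes X: "smooth_vfield A X"
  shows "smooth_vfield A (PH X)"
  unfolding smooth_vfield_on_def
proof
  fix c assume c: "c \<in> A"
  note cc = manifold_chart[OF manifold_A c]
  show "smooth_on (\<lambda>x. to_chart A c (chart_inv c x) (PH X (chart_inv c x)))
      (chart_fun c ` (chart_dom c \<inter> UNIV))"
  proof (rule smooth_on_local)
    fix x assume "x \<in> chart_fun c ` (chart_dom c \<inter> UNIV)"
    then obtain p0 where p0: "p0 \<in> chart_dom c" "x = chart_fun c p0" by auto
    obtain U w where U: "open U" "p0 \<in> U" "U \<subseteq> chart_dom c" and w: "smooth_on w (chart_fun c ` U)"
      and hv: "\<And>p. p \<in> U \<Longrightarrow> from_chart A c p (w (chart_fun c p)) \<in> H p"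
        "\<And>p. p \<in> U \<Longrightarrow> X p - from_chart A c p (w (chart_fun c p)) \<in> V p"
      using smooth_horizontal_part_in_chart[OF X c p0(1)] by blast
    have o: "open (chart_fun c ` U)"
      using open_chart_image[OF cc U(1)] U(3) by (simp add: Int_absorb1)
    have "smooth_on (\<lambda>x. to_chart A c (chart_inv c x) (PH X (chart_inv c x))) (chart_fun c ` U)"
    proof (rule smooth_on_cong[OF o _ w])
      fix y assume "y \<in> chart_fun c ` U"
      then obtain p where p: "p \<in> U" "y = chart_fun c p" by auto
      have pc: "p \<in> chart_dom c" using p(1) U(3) by auto
      show "w y = to_chart A c (chart_inv c y) (PH X (chart_inv c y))"
        by (simp add: p(2) chart_inv_chart_fun[OF cc pc] PH_eqI[where X = X, OF hv[OF p(1)]]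
            to_chart_from_chart[OF manifold_A c pc])
    qed
    then show "\<exists>U. open U \<and> x \<in> U \<and>
        smooth_on (\<lambda>x. to_chart A c (chart_inv c x) (PH X (chart_inv c x))) U"
      using o U(2) p0(2) by blast
  qed
qed

lemma smooth_PV:
  assumes X: "smooth_vfield A X"
  shows "smooth_vfield A (PV X)"
proof -
  have "PV X = (\<lambda>p. X p - PH X p)" using PV_eq[OF X] by blast
  then show ?thesis using smooth_vfield_diff[OF manifold_A X smooth_PH[OF X]] by simp
qed

lemma
  assumes "\<And>p. X p \<in> H p"
  shows PH_horizontal: "PH X = X" and PV_horizontal: "PV X = (\<lambda>p. 0)"
  using PH_eqI[of "X _" _ X] PV_eqI[of 0 _ X] assms subspace_0[OF subspace_V] by fastforce+

lemma
  assumes "\<And>p. X p \<in> V p"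
  shows PV_vertical: "PV X = X" and PH_vertical: "PH X = (\<lambda>p. 0)"
  using PV_eqI[of "X _" _ X] PH_eqI[of 0 _ X] assms subspace_0[OF subspace_H] by fastforce+

lemma PH_add:
  assumes "smooth_vfield A X" "smooth_vfield A Y"
  shows "PH (\<lambda>p. X p + Y p) p = PH X p + PH Y p"
proof (rule PH_eqI)
  show "PH X p + PH Y p \<in> H p" by (intro subspace_add subspace_H PH_mem assms)
  have "PV X p + PV Y p \<in> V p" by (intro subspace_add subspace_V PV_mem assms)
  then show "X p + Y p - (PH X p + PH Y p) \<in> V p"
    by (simp add: PV_eq assms algebra_simps)
qed

lemma PV_add:
  assumes "smooth_vfield A X" "smooth_vfield A Y"
  shows "PV (\<lambda>p. X p + Y p) p = PV X p + PV Y p"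
proof (rule PV_eqI)
  show "PV X p + PV Y p \<in> V p" by (intro subspace_add subspace_V PV_mem assms)
  have "PH X p + PH Y p \<in> H p" by (intro subspace_add subspace_H PH_mem assms)
  then show "X p + Y p - (PV X p + PV Y p) \<in> H p"
    by (simp add: PV_eq assms algebra_simps)
qed

end

section \<open>The complex structure and the splitting\<close>

locale semi_invariant = metric_submersion A g B g2 F
  for A :: "('a::{t2_space,second_countable_topology}, 'e::euclidean_space) chart set"
    and g :: "'a \<Rightarrow> 'e \<Rightarrow> 'e \<Rightarrow> real"
    and B :: "('b::{t2_space,second_countable_topology}, 'f::euclidean_space) chart set"
    and g2 :: "'b \<Rightarrow> 'f \<Rightarrow> 'f \<Rightarrow> real"
    and F :: "'a \<Rightarrow> 'b" +
  fixes J :: "'a \<Rightarrow> 'e \<Rightarrow> 'e" and D1 :: "'a \<Rightarrow> 'e set"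
  assumes semi_invariant: "semi_invariant_submersion A g J B g2 F D1"
begin

abbreviation "\<D>\<^sub>2 \<equiv> D2 A g B F D1"
abbreviation "\<mu> \<equiv> mu A g J B F D1"
abbreviation "\<B> \<equiv> B_op A g J B F D1"
abbreviation "\<C> \<equiv> C_op A g J B F D1"

lemma
  shows linear_J: "linear (J p)" and J_J: "J p (J p v) = - v"
    and J_isometry: "g p (J p v) (J p w) = g p v w"
    and smooth_J: "c \<in> A \<Longrightarrow> smooth_vfield_on A (chart_dom c) (\<lambda>p. J p (from_chart A c p v))"
  using semi_invariant by (auto simp: semi_invariant_submersion_def almost_hermitian_def)

lemma
  shows D1_vertical: "a \<in> D1 p \<Longrightarrow> a \<in> V p" and J_D1: "a \<in> D1 p \<Longrightarrow> J p a \<in> D1 p"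
    and J_D2: "b \<in> \<D>\<^sub>2 p \<Longrightarrow> J p b \<in> H p"
    and V_split: "v \<in> V p \<Longrightarrow> \<exists>a\<in>D1 p. \<exists>b\<in>\<D>\<^sub>2 p. v = a + b"
proof -
  have *: "D1 p \<subseteq> V p" "V p = {a + b | a b. a \<in> D1 p \<and> b \<in> \<D>\<^sub>2 p}" "J p ` D1 p = D1 p"
    "J p ` \<D>\<^sub>2 p \<subseteq> H p"
    using semi_invariant unfolding semi_invariant_submersion_def by blast+
  show "a \<in> D1 p \<Longrightarrow> a \<in> V p" "a \<in> D1 p \<Longrightarrow> J p a \<in> D1 p" "b \<in> \<D>\<^sub>2 p \<Longrightarrow> J p b \<in> H p"
    using *(1,3,4) by blast+
  show "v \<in> V p \<Longrightarrow> \<exists>a\<in>D1 p. \<exists>b\<in>\<D>\<^sub>2 p. v = a + b" using *(2) by blast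
qed

lemma mem_D2_iff: "v \<in> \<D>\<^sub>2 p \<longleftrightarrow> v \<in> V p \<and> (\<forall>a\<in>D1 p. g p v a = 0)"
  by (simp add: D2_def orth_in_def)

lemma mem_mu_iff: "v \<in> \<mu> p \<longleftrightarrow> v \<in> H p \<and> (\<forall>b\<in>\<D>\<^sub>2 p. g p v (J p b) = 0)"
  by (simp add: mu_def orth_in_def)

lemma J_skew: "g p (J p v) w = - g p v (J p w)"
  using J_isometry[of p "J p v" w] by (simp add: J_J bilinear_lneg[OF g_bilinear])

text \<open>
  As \<open>J\<close> is skew and maps \<open>D1\<close> to itself, the image of a horizontal vector is
  orthogonal to \<open>D1\<close>; as \<open>J\<close> is isometric, it is orthogonal to the image of
  \<open>\<D>\<^sub>2\<close>.
\<close>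

lemma J_parts_of_horizontal:
  assumes w: "w \<in> H p" and vh: "v \<in> V p" "h \<in> H p" "J p w = v + h"
  shows "v \<in> \<D>\<^sub>2 p" "h \<in> \<mu> p"
proof -
  have "g p v a = 0" if a: "a \<in> D1 p" for a
  proof -
    have "g p v a + g p h a = - g p w (J p a)"
      using J_skew[of p w a] vh(3) by (simp add: bilinear_ladd[OF g_bilinear])
    then show ?thesis
      using H_V_orth(1)[OF vh(2) D1_vertical[OF a]] H_V_orth(1)[OF w D1_vertical[OF J_D1[OF a]]]
      by simp
  qed
  then show "v \<in> \<D>\<^sub>2 p" using vh(1) by (simp add: mem_D2_iff)
  have "g p h (J p b) = 0" if b: "b \<in> \<D>\<^sub>2 p" for b
  proof -
    have "g p v (J p b) + g p h (J p b) = g p w b"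
      using J_isometry[of p w b] vh(3) by (simp add: bilinear_ladd[OF g_bilinear])
    moreover have "b \<in> V p" using b by (simp add: mem_D2_iff)
    ultimately show ?thesis
      using H_V_orth(2)[OF J_D2[OF b] vh(1)] H_V_orth(1)[OF w] by simp
  qed
  then show "h \<in> \<mu> p" using vh(2) by (simp add: mem_mu_iff)
qed

text \<open>
  Testing \<open>w\<close> against \<open>a + b\<close> with \<open>a \<in> D1\<close> and \<open>b \<in> \<D>\<^sub>2\<close> amounts, \<open>J\<close> being
  isometric, to testing \<open>v + h\<close> against \<open>J a\<close>, which lies in \<open>D1\<close> again, and against
  \<open>J b\<close>, which is horizontal. Each of the four products vanishes.
\<close>

lemma horizontal_if_J_parts:
  assumes v: "v \<in> \<D>\<^sub>2 p" and h: "h \<in> \<mu> p" and Jw: "J p w = v + h"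
  shows "w \<in> H p"
  unfolding mem_H_iff
proof
  fix u assume "u \<in> V p"
  then obtain a b where ab: "a \<in> D1 p" "b \<in> \<D>\<^sub>2 p" "u = a + b" using V_split by blast
  note Ja = J_D1[OF ab(1)]
  have "g p w u = g p (v + h) (J p a + J p b)"
    using J_isometry[of p w u] by (simp add: Jw ab(3) linear_add[OF linear_J])
  also have "\<dots> = g p v (J p a) + g p v (J p b) + (g p h (J p a) + g p h (J p b))"
    by (simp add: bilinear_ladd[OF g_bilinear] bilinear_radd[OF g_bilinear])
  also have "\<dots> = 0"
    using v h Ja H_V_orth(2)[OF J_D2[OF ab(2)], of v] H_V_orth(1)[OF _ D1_vertical[OF Ja], of h] ab(2)
    by (simp add: mem_D2_iff mem_mu_iff)
  finally show "g p w u = 0" .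
qed

lemma smooth_vfield_J: "smooth_vfield A X \<Longrightarrow> smooth_vfield A (\<lambda>p. J p (X p))"
  by (rule smooth_vfield_endomorphism[OF manifold_A linear_J smooth_J])

text \<open>
  Applied to \<open>W = nabla Z1 Z2\<close>, the right-hand side is the pair of conditions in the
  theorem.
\<close>

lemma horizontal_iff_J_parts:
  assumes W: "smooth_vfield A W"
  shows "W p \<in> H p \<longleftrightarrow> PH (\<lambda>p. J p (W p)) p \<in> \<mu> p \<and> PV (\<lambda>p. J p (W p)) p \<in> \<D>\<^sub>2 p"
proof -
  note JW = smooth_vfield_J[OF W]
  have "J p (W p) = PV (\<lambda>p. J p (W p)) p + PH (\<lambda>p. J p (W p)) p" by (simp add: PV_eq[OF JW])
  then show ?thesis
    using J_parts_of_horizontal[OF _ PV_mem[OF JW] PH_mem[OF JW]] horizontal_if_J_parts by blast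
qed

text \<open>
  On horizontal fields the operators \<open>\<B>\<close> and \<open>\<C>\<close> are the vertical and the
  horizontal part of \<open>J Z\<close>, since \<open>\<D>\<^sub>2\<close> is vertical and \<open>\<mu>\<close> is horizontal. This is
  what makes \<open>\<B> Z\<close> and \<open>\<C> Z\<close> smooth, so that the connection may be applied to them.
\<close>

lemma
  assumes Z: "Z \<in> sections A H"
  shows B_op_eq: "\<B> Z = PV (\<lambda>p. J p (Z p))" and C_op_eq: "\<C> Z = PH (\<lambda>p. J p (Z p))"
proof -
  have smZ: "smooth_vfield A Z" and ZH: "Z p \<in> H p" for p using Z by (auto simp: sections_def)
  note JZ = smooth_vfield_J[OF smZ]
  let ?JZ = "\<lambda>p. J p (Z p)"
  have parts: "PH ?JZ p \<in> \<mu> p" "PV ?JZ p \<in> \<D>\<^sub>2 p" "?JZ p = PV ?JZ p + PH ?JZ p" for p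
    using horizontal_iff_J_parts[OF smZ] ZH by (auto simp: PV_eq[OF JZ])
  have uniq: "b = PV ?JZ p \<and> c = PH ?JZ p" if bc: "b \<in> \<D>\<^sub>2 p" "c \<in> \<mu> p" "?JZ p = b + c" for b c p
  proof -
    have "b \<in> V p" "c \<in> H p" using bc by (auto simp: mem_D2_iff mem_mu_iff)
    then show ?thesis using PV_eqI[of b p ?JZ] PH_eqI[of c p ?JZ] bc(3) by simp
  qed
  show "\<B> Z = PV ?JZ"
  proof
    show "\<B> Z p = PV ?JZ p" for p
      unfolding B_op_def by (rule the_equality) (use parts uniq in blast)+
  qed
  show "\<C> Z = PH ?JZ"
  proof
    show "\<C> Z p = PH ?JZ p" for p
      unfolding C_op_def by (rule the_equality) (use parts uniq in blast)+
  qed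
qed

end

section \<open>Total geodesy\<close>

lemma connection_zero:
  assumes "smooth_manifold A" "affine_connection A nabla" "smooth_vfield A X"
  shows "nabla X (\<lambda>p. 0) = (\<lambda>p. 0)"
proof -
  have "nabla X (\<lambda>p. 0 + 0) = (\<lambda>p. nabla X (\<lambda>p. 0) p + nabla X (\<lambda>p. 0) p)"
    using assms(2,3) smooth_vfield_zero[OF assms(1)] unfolding affine_connection_def by blast
  then show ?thesis by (simp add: fun_eq_iff)
qed

lemma (in metric_submersion)
  assumes nabla: "affine_connection A nabla" and Z: "Z \<in> sections A H"
  shows oneill_A_vertical: "(\<And>p. X p \<in> V p) \<Longrightarrow> oneill_A A g nabla B F Z X p = PH (nabla Z X) p"
    and oneill_A_horizontal: "(\<And>p. X p \<in> H p) \<Longrightarrow> oneill_A A g nabla B F Z X p = PV (nabla Z X) p"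
proof -
  have Z': "smooth_vfield A Z" "\<And>p. Z p \<in> H p" using Z by (auto simp: sections_def)
  have 0: "PH (\<lambda>p. 0) = (\<lambda>p. 0)" "PV (\<lambda>p. 0) = (\<lambda>p. 0)"
    using PH_vertical[of "\<lambda>p. 0"] PV_horizontal[of "\<lambda>p. 0"] subspace_0 subspace_H subspace_V
    by blast+
  note simps = oneill_A_def PH_horizontal[OF Z'(2)] connection_zero[OF manifold_A nabla Z'(1)] 0
  show "oneill_A A g nabla B F Z X p = PH (nabla Z X) p" if "\<And>p. X p \<in> V p"
    by (simp add: simps PV_vertical[OF that] PH_vertical[OF that])
  show "oneill_A A g nabla B F Z X p = PV (nabla Z X) p" if "\<And>p. X p \<in> H p"
    by (simp add: simps PV_horizontal[OF that] PH_horizontal[OF that])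
qed

text \<open>
  On the vertical field \<open>\<B> Z2\<close> the tensor of O'Neill is the horizontal part of the covariant
  derivative, on the horizontal field \<open>\<C> Z2\<close> it is the vertical part. Hence the two expressions
  collect the horizontal and the vertical parts of \<open>nabla Z1 (\<B> Z2 + \<C> Z2)\<close>, which is
  \<open>nabla Z1 (J Z2) = J (nabla Z1 Z2)\<close> because \<open>J\<close> is parallel.
\<close>

lemma (in semi_invariant) parts_of_J_nabla:
  assumes K: "kaehler A g J nabla" and Z1: "Z1 \<in> sections A H" and Z2: "Z2 \<in> sections A H"
  shows "oneill_A A g nabla B F Z1 (\<B> Z2) p + PH (nabla Z1 (\<C> Z2)) p
      = PH (\<lambda>p. J p (nabla Z1 Z2 p)) p"
    and "oneill_A A g nabla B F Z1 (\<C> Z2) p + PV (nabla Z1 (\<B> Z2)) p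
      = PV (\<lambda>p. J p (nabla Z1 Z2 p)) p"
proof -
  have nabla: "affine_connection A nabla" using K by (simp add: kaehler_def levi_civita_def)
  have sm: "smooth_vfield A Z1" "smooth_vfield A Z2" using Z1 Z2 by (auto simp: sections_def)
  let ?JZ = "\<lambda>p. J p (Z2 p)"
  note JZ = smooth_vfield_J[OF sm(2)]
  have BC: "smooth_vfield A (\<B> Z2)" "smooth_vfield A (\<C> Z2)" "\<And>p. \<B> Z2 p \<in> V p"
    "\<And>p. \<C> Z2 p \<in> H p" "?JZ = (\<lambda>p. \<B> Z2 p + \<C> Z2 p)"
    using smooth_PV[OF JZ] smooth_PH[OF JZ] PV_mem[OF JZ] PH_mem[OF JZ]
    by (simp_all add: B_op_eq[OF Z2] C_op_eq[OF Z2] PV_eq[OF JZ])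
  have smn: "smooth_vfield A (nabla Z1 (\<B> Z2))" "smooth_vfield A (nabla Z1 (\<C> Z2))"
    using nabla sm(1) BC(1,2) by (auto simp: affine_connection_def)
  have "J p (nabla Z1 Z2 p) = nabla Z1 (\<B> Z2) p + nabla Z1 (\<C> Z2) p" for p
  proof -
    have "J p (nabla Z1 Z2 p) = nabla Z1 ?JZ p" using K sm by (simp add: kaehler_def)
    also have "\<dots> = nabla Z1 (\<B> Z2) p + nabla Z1 (\<C> Z2) p"
      unfolding BC(5) using nabla sm(1) BC(1,2) by (simp add: affine_connection_def)
    finally show ?thesis .
  qed
  then show "oneill_A A g nabla B F Z1 (\<B> Z2) p + PH (nabla Z1 (\<C> Z2)) p
      = PH (\<lambda>p. J p (nabla Z1 Z2 p)) p"
    "oneill_A A g nabla B F Z1 (\<C> Z2) p + PV (nabla Z1 (\<B> Z2)) p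
      = PV (\<lambda>p. J p (nabla Z1 Z2 p)) p"
    by (simp_all add: oneill_A_vertical[OF nabla Z1 BC(3)] oneill_A_horizontal[OF nabla Z1 BC(4)]
        PH_add[OF smn] PV_add[OF smn])
qed

theorem proposition3p5:
  fixes A1 :: "('a::{t2_space,second_countable_topology}, 'e::euclidean_space) chart set"
    and g1 :: "'a \<Rightarrow> 'e \<Rightarrow> 'e \<Rightarrow> real"
    and J :: "'a \<Rightarrow> 'e \<Rightarrow> 'e"
    and nabla :: "('a \<Rightarrow> 'e) \<Rightarrow> ('a \<Rightarrow> 'e) \<Rightarrow> 'a \<Rightarrow> 'e"
    and A2 :: "('b::{t2_space,second_countable_topology}, 'f::euclidean_space) chart set"
    and g2 :: "'b \<Rightarrow> 'f \<Rightarrow> 'f \<Rightarrow> real"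
    and F :: "'a \<Rightarrow> 'b"
    and D1 :: "'a \<Rightarrow> 'e set"
  assumes "levi_civita A1 g1 nabla"
    and "kaehler A1 g1 J nabla"
    and "riemannian_manifold A2 g2"
    and "semi_invariant_submersion A1 g1 J A2 g2 F D1"
  shows "totally_geodesic_foliation A1 nabla (hor A1 g1 A2 F) \<longleftrightarrow>
    (\<forall>Z1 \<in> sections A1 (hor A1 g1 A2 F). \<forall>Z2 \<in> sections A1 (hor A1 g1 A2 F).
       (let BZ2 = B_op A1 g1 J A2 F D1 Z2;
            CZ2 = C_op A1 g1 J A2 F D1 Z2
        in (\<lambda>p. oneill_A A1 g1 nabla A2 F Z1 BZ2 p + H_proj A1 g1 A2 F (nabla Z1 CZ2) p)
             \<in> sections A1 (mu A1 g1 J A2 F D1) \<and>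
           (\<lambda>p. oneill_A A1 g1 nabla A2 F Z1 CZ2 p + V_proj A1 g1 A2 F (nabla Z1 BZ2) p)
             \<in> sections A1 (D2 A1 g1 A2 F D1)))"
proof -
  have "riemannian_submersion A1 g1 A2 g2 F"
    using assms(4) unfolding semi_invariant_submersion_def by blast
  with assms(4) interpret semi_invariant A1 g1 A2 g2 F J D1
    by unfold_locales
  have "nabla Z1 Z2 \<in> sections A1 H \<longleftrightarrow>
      (\<lambda>p. oneill_A A1 g1 nabla A2 F Z1 (\<B> Z2) p + PH (nabla Z1 (\<C> Z2)) p) \<in> sections A1 \<mu> \<and>
      (\<lambda>p. oneill_A A1 g1 nabla A2 F Z1 (\<C> Z2) p + PV (nabla Z1 (\<B> Z2)) p) \<in> sections A1 \<D>\<^sub>2"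
    if Z: "Z1 \<in> sections A1 H" "Z2 \<in> sections A1 H" for Z1 Z2
  proof -
    have W: "smooth_vfield A1 (nabla Z1 Z2)"
      using assms(1) Z by (auto simp: levi_civita_def affine_connection_def sections_def)
    note JW = smooth_vfield_J[OF W]
    show ?thesis
      unfolding parts_of_J_nabla[OF assms(2) Z] sections_def
      using W smooth_PH[OF JW] smooth_PV[OF JW] horizontal_iff_J_parts[OF W] by auto
  qed
  then show ?thesis unfolding totally_geodesic_foliation_def Let_def by blast
qed

end
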